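(* Let $s_*>0$, $\beta\ge0$, and for $F\subset\mathbb{S}^2$ of finite perimeter let $$\mathcal{E}_0(F)=\sqrt[4]{24}\,s_*\int_F(1-\cos\theta)\,\mathrm{d}\omega+\sqrt[4]{24}\,s_*\int_{F^c}(1+\cos\theta)\,\mathrm{d}\omega+\frac\pi2s_*^2\beta|D\chi_F|(\mathbb{S}^2).$$ (i) If $F$ minimizes $\mathcal{E}_0$ among the measurable sets of finite perimeter in $\mathbb{S}^2$ that are invariant under rotations about the $\mathbf{e}_3$-axis, then (up to null sets) $F$ and $F^c$ are connected. (ii) For $\theta_d\in[0,\pi]$ and $F_{\theta_d}=\{0\le\theta\le\theta_d\}$, $$\mathcal{E}_0(F_{\theta_d})=4\sqrt[4]{24}\,\pi s_*\big(\sin^4(\theta_d/2)+\cos^4(\theta_d/2)\big)+\pi^2\beta s_*^2\sin(\theta_d),$$ and the critical points of $\theta_d\mapsto\mathcal{E}_0(F_{\theta_d})$ are the solutions of $\cos(\theta_d)\big(\pi\beta s_*-4\sqrt[4]{24}\sin(\theta_d)\big)=0$. (iii) If $\beta s_*\ge\frac{4\sqrt[4]{24}}{\pi}$, the only local minimizers of $\theta_d\mapsto\mathcal{E}_0(F_{\theta_d})$ on $[0,\pi]$ are $\theta_d=0$ and $\theta_d=\pi$ (dipole). (iv) The energies of $\theta_d=\pi/2$ (saturn ring) and $\theta_d=0$ (dipole) are equal for $\beta s_*=\frac{2\sqrt[4]{24}}{\pi}$; for greater values of $\beta s_*$ the dipole is the globally energy-minimizing configuration, and for smaller values the saturn ring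 is. (v) $\theta_d=\pi/2$ is the only local minimizer of $\theta_d\mapsto\mathcal{E}_0(F_{\theta_d})$ on $[0,\pi]$ if and only if $\beta s_*=0$.
   Context: $\theta\in[0,\pi]$ is the angle between a point $\omega\in\mathbb{S}^2$ and $\mathbf{e}_3$; $\mathrm{d}\omega$ is surface measure; $F^c=\mathbb{S}^2\setminus F$; $|D\chi_F|(\mathbb{S}^2)$ denotes the perimeter of $F$ in $\mathbb{S}^2$. The dipole configurations $\theta_d=0,\pi$ correspond to $F$ of measure zero and $F=\mathbb{S}^2$, respectively (the empty set counts as connected). The saturn ring configuration is $\theta_d=\pi/2$. *)

theory Defs
  imports "HOL-Analysis.Analysis"
begin

type_synonym R3 = "real ^ 3"

abbreviation S2 :: "R3 set" where
  "S2 \<equiv> sphere 0 1"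

abbreviation e3 :: R3 where
  "e3 \<equiv> axis 3 1"

definition polar_angle :: "R3 \<Rightarrow> real" where
  "polar_angle x = arccos (x \<bullet> e3)"

definition sphere_coords :: "real \<times> real \<Rightarrow> R3" where
  "sphere_coords = (\<lambda>(t, p). vector [sin t * cos p, sin t * sin p, cos t])"

lemma sphere_coords_nth [simp]:
  "sphere_coords (t, p) $ 1 = sin t * cos p"
  "sphere_coords (t, p) $ 2 = sin t * sin p"
  "sphere_coords (t, p) $ 3 = cos t"
  by (simp_all add: sphere_coords_def)

lemma sphere_coords_in_S2: "sphere_coords z \<in> S2"
proof (cases z)
  case (Pair t p)
  have "(sin t * cos p)\<^sup>2 + (sin t * sin p)\<^sup>2 = (sin t)\<^sup>2 * ((sin p)\<^sup>2 + (cos p)\<^sup>2)"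
    by (simp only: power_mult_distrib distrib_left add.commute)
  then have "(sin t * cos p)\<^sup>2 + (sin t * sin p)\<^sup>2 + (cos t)\<^sup>2 = 1"
    by simp
  then show ?thesis
    by (simp only: Pair mem_sphere_0 norm_vec_def L2_set_def sum_3 real_norm_def power2_abs
        sphere_coords_nth real_sqrt_one)
qed

text \<open>The completion makes the measurable subsets of the sphere the Lebesgue measurable ones.\<close>

definition surface_measure :: "R3 measure" where
  "surface_measure = completion (distr
     (density lborel (\<lambda>(t, p). ennreal (sin t) * indicator ({0..pi} \<times> {0..2 * pi}) (t, p)))
     (restrict_space borel S2) sphere_coords)"

lemma sphere_coords_measurable: "sphere_coords \<in> borel \<rightarrow>\<^sub>M restrict_space borel S2"
proof (rule measurable_restrict_space2)
  have "continuous_on UNIV (\<lambda>z. sphere_coords z $ i)" for i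
  proof -
    have "(\<lambda>z. sphere_coords z $ i) \<in> {\<lambda>z. sin (fst z) * cos (snd z), \<lambda>z. sin (fst z) * sin (snd z),
        \<lambda>z. cos (fst z)}"
      using exhaust_3[of i] by (auto simp: sphere_coords_def case_prod_unfold)
    then show ?thesis
      by (elim insertE emptyE; simp only:; intro continuous_intros)
  qed
  then have "continuous_on UNIV (\<lambda>z. \<chi> i. sphere_coords z $ i)"
    by (intro continuous_on_vec_lambda)
  then show "sphere_coords \<in> borel \<rightarrow>\<^sub>M borel"
    by (intro borel_measurable_continuous_onI) simp
qed (simp add: sphere_coords_in_S2[simplified])

text \<open>
  A \<open>C\<^sup>1\<close> tangent field on the sphere is represented by a \<open>C\<^sup>1\<close> extension to the whole space.
  The tangential divergence (trace of the derivative minus its normal part) does not depend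
  on the extension.
\<close>

definition C1_field :: "(R3 \<Rightarrow> R3) \<Rightarrow> bool" where
  "C1_field X \<longleftrightarrow> (\<exists>X' :: R3 \<Rightarrow> R3 \<Rightarrow>\<^sub>L R3.
     (\<forall>x. (X has_derivative blinfun_apply (X' x)) (at x)) \<and> continuous_on UNIV X')"

definition tangential_div :: "(R3 \<Rightarrow> R3) \<Rightarrow> R3 \<Rightarrow> real" where
  "tangential_div X x =
     (\<Sum>b\<in>Basis. frechet_derivative X (at x) b \<bullet> b) - frechet_derivative X (at x) x \<bullet> x"

definition test_fields :: "(R3 \<Rightarrow> R3) set" where
  "test_fields = {X. C1_field X \<and> (\<forall>x\<in>S2. X x \<bullet> x = 0 \<and> norm (X x) \<le> 1)}"

text \<open>The total variation \<open>|D\<chi>\<^sub>F|\<close> of the sphere.\<close>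

definition perimeter :: "R3 set \<Rightarrow> ereal" where
  "perimeter F = (SUP X\<in>test_fields. ereal (LINT x:F|surface_measure. tangential_div X x))"

definition finite_perimeter :: "R3 set \<Rightarrow> bool" where
  "finite_perimeter F \<longleftrightarrow> F \<in> sets surface_measure \<and> perimeter F < \<infinity>"

text \<open>To be used only for sets of finite perimeter, since \<^const>\<open>real_of_ereal\<close> sends \<open>\<infinity>\<close> to 0.\<close>

definition E0 :: "real \<Rightarrow> real \<Rightarrow> R3 set \<Rightarrow> real" where
  "E0 s \<beta> F =
     root 4 24 * s * (LINT x:F|surface_measure. 1 - cos (polar_angle x))
   + root 4 24 * s * (LINT x:(S2 - F)|surface_measure. 1 + cos (polar_angle x))
   + pi / 2 * s\<^sup>2 * \<beta> * real_of_ereal (perimeter F)"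

definition rot_e3 :: "real \<Rightarrow> R3 \<Rightarrow> R3" where
  "rot_e3 a x = vector [cos a * x $ 1 - sin a * x $ 2, sin a * x $ 1 + cos a * x $ 2, x $ 3]"

definition axisymmetric :: "R3 set \<Rightarrow> bool" where
  "axisymmetric F \<longleftrightarrow> (\<forall>a. rot_e3 a ` F = F)"

definition admissible :: "R3 set \<Rightarrow> bool" where
  "admissible F \<longleftrightarrow> finite_perimeter F \<and> axisymmetric F"

definition eq_ae :: "R3 set \<Rightarrow> R3 set \<Rightarrow> bool" where
  "eq_ae F G \<longleftrightarrow> sym_diff F G \<in> null_sets surface_measure"

text \<open>
  The representative has to be rotation invariant itself: with arbitrary null modifications
  the notion would be void, since adding a meridian arc to an axisymmetric set, or removing
  one, can make the set and its complement connected.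
\<close>

definition ae_connected_with_complement :: "R3 set \<Rightarrow> bool" where
  "ae_connected_with_complement F \<longleftrightarrow>
     (\<exists>G \<subseteq> S2. axisymmetric G \<and> eq_ae F G \<and> connected G \<and> connected (S2 - G))"

definition cap :: "real \<Rightarrow> R3 set" where
  "cap t = {x \<in> S2. 0 \<le> polar_angle x \<and> polar_angle x \<le> t}"

definition local_minimizer_on :: "('a::topological_space \<Rightarrow> real) \<Rightarrow> 'a set \<Rightarrow> 'a \<Rightarrow> bool" where
  "local_minimizer_on f S x \<longleftrightarrow> x \<in> S \<and> (\<forall>\<^sub>F y in at x within S. f x \<le> f y)"

end

theory Submission
  imports Defs
begin

text \<open>
  Write \<open>z\<close> for the height \<open>cos \<theta>\<close> and \<open>c\<close> for the fourth root of 24. Since the sphere has area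
  \<open>4 \<pi>\<close> and mean height zero, the energy depends on \<open>F\<close> only through its height integral
  \<open>I(F) = \<integral>\<^sub>F z\<close> and its perimeter \<open>P(F)\<close>:
  \<open>E\<^sub>0(F) = c s (4 \<pi> - 2 I(F)) + \<pi>/2 s\<^sup>2 \<beta> P(F)\<close>.

  The global statements come from one calibration. The tangent field \<open>X\<^sub>0(x) = z x - e\<^sub>3\<close>, minus the
  gradient of the height, has length at most 1 and tangential divergence \<open>2 z\<close>. Testing the perimeter
  with \<open>X\<^sub>0\<close> gives \<open>2 I(F) \<le> P(F)\<close> for every \<open>F\<close>. Together with \<open>I(F) \<le> \<pi>\<close>, where equality forces
  \<open>F\<close> to be the upper hemisphere up to null sets, this bounds \<open>E\<^sub>0\<close> from below by the dipole energy when
  \<open>\<beta> s \<ge> 2 c / \<pi>\<close> and by the saturn ring energy when \<open>\<beta> s \<le> 2 c / \<pi>\<close>.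

  The equality case \<open>P(F) = 2 I(F)\<close> for axisymmetric \<open>F\<close>
  (\<open>axisymmetric_calibration_equality\<close>) identifies the minimizers from the threshold upwards. The length of
  \<open>X\<^sub>0\<close> is \<open>sin \<theta>\<close>, which reaches 1 only at the equator, so \<open>(1 \<plusminus> z\<^bsup>n+2\<^esup> / 4) X\<^sub>0\<close> is still admissible and
  the first variation in every such direction vanishes. This is a recurrence for the moments
  of the indicator of \<open>F\<close> in the variable \<open>cos \<theta>\<close>, and it leaves only functions that are constant on each
  hemisphere (\<open>moment_recurrence_imp_step\<close>). Hence \<open>F\<close> is null, conull, or one of the two
  hemispheres, and each of these is connected with connected complement.

  The perimeter of a cap is \<open>2 \<pi> sin \<theta>\<^sub>d\<close>. The upper bound is the divergence theorem in polar coordinates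
  (\<open>cap_divergence\<close>), and the lower bound comes from a multiple of \<open>X\<^sub>0\<close> that has length 1 exactly on
  the boundary circle (\<open>cap_field\<close>). With \<open>y = sin \<theta>\<^sub>d\<close> the cap energy is \<open>A (1 - y\<^sup>2 / 2) + B y\<close>
  for \<open>A = 4 c \<pi> s\<close> and \<open>B = \<pi>\<^sup>2 \<beta> s\<^sup>2\<close>, and the remaining claims are calculus for this function.
\<close>

section \<open>The surface measure in polar coordinates\<close>

definition rect :: "(real \<times> real) set" where
  "rect = {0..pi} \<times> {0..2 * pi}"

definition coord_measure :: "(real \<times> real) measure" where
  "coord_measure = density lborel (\<lambda>(t, p). ennreal (sin t) * indicator ({0..pi} \<times> {0..2 * pi}) (t, p))"

text \<open>The surface measure before completion: statements about images under \<^const>\<open>sphere_coords\<close> are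
  proved for its Borel sets and carried over to Lebesgue measurable sets by Borel representatives.\<close>

definition borel_surface_measure :: "R3 measure" where
  "borel_surface_measure = distr coord_measure (restrict_space borel S2) sphere_coords"

lemma surface_measure_eq: "surface_measure = completion borel_surface_measure"
  by (simp add: surface_measure_def borel_surface_measure_def coord_measure_def)

lemma borel_rect [measurable]: "rect \<in> sets borel"
  unfolding rect_def by (simp add: borel_closed closed_Times)

lemma coord_measure_rect:
  "coord_measure = density lborel (\<lambda>z. ennreal (sin (fst z) * indicator rect z))"
  unfolding coord_measure_def
  by (rule arg_cong[where f = "density lborel"])
     (auto simp: fun_eq_iff rect_def indicator_def)

lemma measurable_sin_fst_rect [measurable]: "(\<lambda>z. sin (fst z) * indicator rect z) \<in> borel_measurable borel"
proof -
  have "(\<lambda>z::real\<times>real. sin (fst z)) \<in> borel_measurable borel"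
    by (intro borel_measurable_continuous_onI continuous_intros)
  then show ?thesis by measurable
qed

lemma sin_rect_nonneg: "0 \<le> sin (fst z) * indicator rect z"
  by (auto simp: rect_def indicator_def sin_ge_zero)

lemma space_coord [simp]: "space coord_measure = UNIV"
  and sets_coord [measurable_cong, simp]: "sets coord_measure = sets borel"
  by (simp_all add: coord_measure_def)

lemma space_borel_surface [simp]: "space borel_surface_measure = S2"
  and sets_borel_surface [measurable_cong]: "sets borel_surface_measure = sets (restrict_space borel S2)"
  by (auto simp add: borel_surface_measure_def space_restrict_space)

lemma space_surface [simp]: "space surface_measure = S2"
  by (simp add: surface_measure_eq)

lemma sphere_coords_measurable_coord [measurable]: "sphere_coords \<in> coord_measure \<rightarrow>\<^sub>M restrict_space borel S2"
  using sphere_coords_measurable by (simp cong: measurable_cong_sets)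

lemma integral_coord:
  fixes w :: "real \<times> real \<Rightarrow> real"
  assumes [measurable]: "w \<in> borel_measurable borel"
  shows "(LINT z|coord_measure. w z) = (LINT z:rect|lborel. sin (fst z) * w z)"
proof -
  have "(LINT z|coord_measure. w z) = (LINT z|lborel. (sin (fst z) * indicator rect z) *\<^sub>R w z)"
    unfolding coord_measure_rect
    by (rule integral_density) (use measurable_sin_fst_rect sin_rect_nonneg in auto)
  then show ?thesis
    by (simp add: set_lebesgue_integral_def mult_ac)
qed

lemma rect_measure_finite: "emeasure lborel rect < \<infinity>"
proof -
  have "rect = cbox (0,0) (pi, 2*pi)"
    by (auto simp: rect_def cbox_Pair_eq)
  then show ?thesis using emeasure_lborel_cbox_finite[of "(0,0)" "(pi, 2*pi)"] by simp
qed

lemma finite_coord: "finite_measure coord_measure"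
proof
  have "emeasure coord_measure (space coord_measure) = (\<integral>\<^sup>+z. ennreal (sin (fst z) * indicator rect z) \<partial>lborel)"
    by (simp add: coord_measure_rect emeasure_density)
  also have "\<dots> \<le> (\<integral>\<^sup>+z. indicator rect z \<partial>lborel)"
    by (intro nn_integral_mono) (auto simp: indicator_def)
  also have "\<dots> < \<infinity>" using rect_measure_finite by simp
  finally show "emeasure coord_measure (space coord_measure) \<noteq> \<infinity>" by simp
qed

lemma finite_borel_surface: "finite_measure borel_surface_measure"
  unfolding borel_surface_measure_def
  by (intro finite_measure.finite_measure_distr finite_coord) simp

lemma finite_surface: "finite_measure surface_measure"
proof -
  interpret finite_measure borel_surface_measure by (rule finite_borel_surface)
  have "S2 \<in> sets borel_surface_measure"
    using sets.top[of borel_surface_measure] by simp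
  then have "emeasure surface_measure S2 = emeasure borel_surface_measure S2"
    by (simp add: surface_measure_eq)
  then show ?thesis
    by (intro finite_measureI) (simp add: emeasure_finite)
qed

lemma borel_imp_borel_surface:
  "f \<in> borel_measurable borel \<Longrightarrow> f \<in> borel_measurable borel_surface_measure"
  by (simp add: measurable_restrict_space1 cong: measurable_cong_sets add: sets_borel_surface)

lemma borel_imp_surface:
  "f \<in> borel_measurable borel \<Longrightarrow> f \<in> borel_measurable surface_measure"
  by (simp add: surface_measure_eq borel_imp_borel_surface measurable_completion)

lemma sets_borel_surfaceI: "A \<in> sets borel \<Longrightarrow> A \<inter> S2 \<in> sets borel_surface_measure"
  by (auto simp: sets_borel_surface sets_restrict_space)

lemma sets_surfaceI: "A \<in> sets borel_surface_measure \<Longrightarrow> A \<in> sets surface_measure"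
  by (simp add: surface_measure_eq)

lemma surface_subset: "F \<in> sets surface_measure \<Longrightarrow> F \<subseteq> S2"
  using sets.sets_into_space by fastforce

lemma integrable_surface_continuous:
  fixes f :: "R3 \<Rightarrow> real"
  assumes f: "continuous_on UNIV f" 
  shows "integrable surface_measure f"
proof -
  interpret finite_measure surface_measure by (rule finite_surface)
  have "compact (f ` S2)"
    by (intro compact_continuous_image continuous_on_subset[OF f]) auto
  then have "bounded (f ` S2)" by (rule compact_imp_bounded)
  then obtain B where "\<forall>y\<in>f ` S2. norm y \<le> B" unfolding bounded_iff ..
  then have B: "\<bar>f x\<bar> \<le> B" if "x \<in> S2" for x using that by fastforce
  show ?thesis
    using f B
    by (intro integrable_const_bound[where B=B] borel_imp_surface borel_measurable_continuous_onI AE_I2)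
       auto
qed

lemma set_integrable_surface:
  fixes f :: "R3 \<Rightarrow> real"
  assumes "continuous_on UNIV f" "F \<in> sets surface_measure"
  shows "set_integrable surface_measure F f"
  unfolding set_integrable_def
  using assms by (intro integrable_mult_indicator integrable_surface_continuous)

lemma eq_ae_iff:
  assumes "F \<in> sets surface_measure" "G \<in> sets surface_measure"
  shows "eq_ae F G \<longleftrightarrow> (AE x in surface_measure. x \<in> F \<longleftrightarrow> x \<in> G)"
proof -
  have eq: "{x \<in> space surface_measure. \<not> (x \<in> F \<longleftrightarrow> x \<in> G)} = sym_diff F G"
    using assms[THEN surface_subset] by auto
  have "sym_diff F G \<in> sets surface_measure" using assms by auto
  then show ?thesis unfolding eq_ae_def
    by (subst AE_iff_null) (simp_all only: eq)
qed

lemma eq_ae_sets: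
  assumes "F \<in> sets surface_measure" "eq_ae F G" 
  shows "G \<in> sets surface_measure"
proof -
  have "G = (F - sym_diff F G) \<union> (sym_diff F G - F)" by auto
  moreover have "sym_diff F G - F \<in> sets surface_measure"
    using assms by (auto simp: eq_ae_def null_sets_def intro: sets.Diff)
  moreover have "F - sym_diff F G \<in> sets surface_measure"
    using assms by (auto simp: eq_ae_def null_sets_def intro: sets.Diff)
  ultimately show ?thesis by (metis sets.Un)
qed

lemma obtain_borel_rep:
  assumes "F \<in> sets surface_measure"
  obtains G where "G \<in> sets borel_surface_measure" "AE x in borel_surface_measure. x \<in> G \<longleftrightarrow> x \<in> F"
  using assms AE_in_main_part[of F borel_surface_measure] main_part_sets[of F borel_surface_measure]
  by (metis surface_measure_eq)

lemma AE_sphere_coords: "AE x in borel_surface_measure. P x \<Longrightarrow> AE z in coord_measure. P (sphere_coords z)"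
  unfolding borel_surface_measure_def by (rule AE_distrD) simp_all

text \<open>One direction is not immediate because the preimage of a Lebesgue measurable set of the sphere need
  not be Borel; passing to Borel representatives first makes the pushed-forward statement measurable.\<close>

lemma eq_ae_iff_coord:
  assumes F: "F \<in> sets surface_measure" and K: "K \<in> sets surface_measure"
  shows "eq_ae F K \<longleftrightarrow> (AE z in coord_measure. sphere_coords z \<in> F \<longleftrightarrow> sphere_coords z \<in> K)"
proof
  assume "eq_ae F K"
  then have "AE x in completion borel_surface_measure. x \<in> F \<longleftrightarrow> x \<in> K"
    unfolding eq_ae_iff[OF F K] surface_measure_eq .
  then have "AE x in borel_surface_measure. x \<in> F \<longleftrightarrow> x \<in> K"
    by (simp only: AE_completion_iff)
  then show "AE z in coord_measure. sphere_coords z \<in> F \<longleftrightarrow> sphere_coords z \<in> K"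
    by (rule AE_sphere_coords)
next
  assume ae: "AE z in coord_measure. sphere_coords z \<in> F \<longleftrightarrow> sphere_coords z \<in> K"
  obtain G where G: "G \<in> sets borel_surface_measure" "AE x in borel_surface_measure. x \<in> G \<longleftrightarrow> x \<in> F"
    using obtain_borel_rep[OF F] .
  obtain H where H: "H \<in> sets borel_surface_measure" "AE x in borel_surface_measure. x \<in> H \<longleftrightarrow> x \<in> K"
    using obtain_borel_rep[OF K] .
  have "AE z in coord_measure. sphere_coords z \<in> G \<longleftrightarrow> sphere_coords z \<in> H"
    using ae AE_sphere_coords[OF G(2)] AE_sphere_coords[OF H(2)] by eventually_elim auto
  moreover have "{x \<in> space (restrict_space borel S2). x \<in> G \<longleftrightarrow> x \<in> H} \<in> sets (restrict_space borel S2)"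
    using G(1) H(1) unfolding sets_borel_surface by measurable
  ultimately have "AE x in borel_surface_measure. x \<in> G \<longleftrightarrow> x \<in> H"
    unfolding borel_surface_measure_def by (subst AE_distr_iff) simp_all
  then have "AE x in borel_surface_measure. x \<in> F \<longleftrightarrow> x \<in> K"
    using G(2) H(2) by eventually_elim auto
  then show "eq_ae F K"
    unfolding eq_ae_iff[OF F K] surface_measure_eq by (simp only: AE_completion_iff)
qed

text \<open>The Borel representative \<open>G\<close> stays in the formula so that Fubini applies to its right-hand side.\<close>

lemma set_integral_sphere_coords:
  fixes f :: "R3 \<Rightarrow> real"
  assumes f: "f \<in> borel_measurable borel" and G: "G \<in> sets borel_surface_measure"
    and ae: "AE x in borel_surface_measure. x \<in> G \<longleftrightarrow> x \<in> F" and F: "F \<in> sets surface_measure"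
  shows "(LINT x:F|surface_measure. f x) =
    (LINT z:rect|lborel. sin (fst z) * (indicator G (sphere_coords z) * f (sphere_coords z)))"
proof -
  have fG: "(\<lambda>x. indicator G x *\<^sub>R f x) \<in> borel_measurable (restrict_space borel S2)"
    using borel_imp_borel_surface[OF f] G unfolding sets_borel_surface 
    by (intro borel_measurable_scaleR borel_measurable_indicator)
      (simp_all cong: measurable_cong_sets add: sets_borel_surface measurable_restrict_space1 f)
  have "(LINT x:F|surface_measure. f x) = (LINT x:G|surface_measure. f x)"
    unfolding set_lebesgue_integral_def
  proof (rule integral_cong_AE)
    show "(\<lambda>x. indicat_real F x *\<^sub>R f x) \<in> borel_measurable surface_measure"
      "(\<lambda>x. indicat_real G x *\<^sub>R f x) \<in> borel_measurable surface_measure"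
      using borel_imp_surface[OF f] F sets_surfaceI[OF G] by auto
    show "AE x in surface_measure. indicat_real F x *\<^sub>R f x = indicat_real G x *\<^sub>R f x"
      unfolding surface_measure_eq AE_completion_iff using ae by eventually_elim (auto simp: indicator_def)
  qed
  also have "\<dots> = (LINT x|borel_surface_measure. indicator G x *\<^sub>R f x)"
    unfolding surface_measure_eq set_lebesgue_integral_def using fG 
    by (intro integral_completion) (simp cong: measurable_cong_sets add: sets_borel_surface)
  also have "\<dots> = (LINT z|coord_measure. indicator G (sphere_coords z) *\<^sub>R f (sphere_coords z))"
    unfolding borel_surface_measure_def using fG by (intro integral_distr) auto
  also have "\<dots> = (LINT z:rect|lborel. sin (fst z) * (indicator G (sphere_coords z) *\<^sub>R f (sphere_coords z)))"
    using measurable_compose[OF sphere_coords_measurable fG] by (intro integral_coord) simp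
  finally show ?thesis by simp
qed

section \<open>The divergence theorem on spherical caps\<close>

lemma sum_Basis_R3: "(\<Sum>b\<in>Basis. f b) = f (axis 1 1) + f (axis 2 1) + f (axis 3 (1::real) :: R3)"
proof -
  have *: "(Basis :: R3 set) = {axis 1 1, axis 2 1, axis 3 1}"
    unfolding Basis_vec_def by (auto simp: UNIV_3)
  show ?thesis unfolding * by (simp add: axis_eq_axis add.assoc)
qed

lemma C1_fieldI:
  assumes "\<And>x. (X has_derivative D x) (at x)" "\<And>h. continuous_on UNIV (\<lambda>x. D x h)"
  shows "C1_field X"
  unfolding C1_field_def
proof (intro exI conjI allI)
  have bl: "blinfun_apply (Blinfun (D x)) = D x" for x
    by (rule bounded_linear_Blinfun_apply[OF has_derivative_bounded_linear[OF assms(1)]])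
  show "(X has_derivative blinfun_apply (Blinfun (D x))) (at x)" for x
    using assms(1)[of x] by (simp add: bl)
  show "continuous_on UNIV (\<lambda>x. Blinfun (D x))"
    by (rule continuous_on_blinfun_componentwise) (simp add: bl assms(2))
qed

lemma tangential_div_eq:
  assumes "(X has_derivative D) (at x)"
  shows "tangential_div X x = (\<Sum>b\<in>Basis. D b \<bullet> b) - D x \<bullet> x"
  unfolding tangential_div_def frechet_derivative_at[OF assms, symmetric] ..

lemma continuous_tangential_div:
  assumes "C1_field X" shows "continuous_on UNIV (tangential_div X)"
proof -
  obtain X' where X': "\<And>x. (X has_derivative blinfun_apply (X' x)) (at x)" "continuous_on UNIV X'"
    using assms unfolding C1_field_def by blast
  have "tangential_div X = (\<lambda>x. (\<Sum>b\<in>Basis. X' x b \<bullet> b) - X' x x \<bullet> x)"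
    by (rule ext) (rule tangential_div_eq[OF X'(1)])
  then show ?thesis by (auto intro!: continuous_intros X'(2))
qed

text \<open>Together with the position vector, \<open>e_theta\<close> and \<open>e_phi\<close> form the orthonormal frame of polar
  coordinates.\<close>

definition e_theta :: "real \<times> real \<Rightarrow> R3" where
  "e_theta = (\<lambda>(t, p). (cos t * cos p) *\<^sub>R axis 1 1 + (cos t * sin p) *\<^sub>R axis 2 1 - sin t *\<^sub>R axis 3 1)"

definition e_phi :: "real \<Rightarrow> R3" where
  "e_phi p = cos p *\<^sub>R axis 2 1 - sin p *\<^sub>R axis 1 1"

lemma sphere_coords_eq:
  "sphere_coords (t, p) = (sin t * cos p) *\<^sub>R axis 1 1 + (sin t * sin p) *\<^sub>R axis 2 1 + cos t *\<^sub>R axis 3 1"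
  by (simp add: vec_eq_iff forall_3 axis_def)

text \<open>The trace does not depend on the orthonormal basis, so removing the normal part leaves the
  two tangential diagonal entries.\<close>

lemma orthonormal_frame_trace:
  assumes "bounded_linear L"
  shows "(\<Sum>b\<in>Basis. L b \<bullet> b) - L (sphere_coords (t, p)) \<bullet> sphere_coords (t, p)
     = L (e_theta (t, p)) \<bullet> e_theta (t, p) + L (e_phi p) \<bullet> e_phi p"
proof -
  interpret L: bounded_linear L by fact
  have s: "(sin t)\<^sup>2 = 1 - (cos t)\<^sup>2" "(sin p)\<^sup>2 = 1 - (cos p)\<^sup>2" by (simp_all add: sin_squared_eq)
  show ?thesis
    unfolding sum_Basis_R3 sphere_coords_eq e_theta_def e_phi_def
    apply (simp add: L.add L.diff L.scaleR inner_add_left inner_add_right inner_diff_left inner_diff_right)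
    using s by algebra
qed

lemma norm_e_theta: "norm (e_theta z) = 1"
proof (cases z)
  case (Pair t p)
  have s: "(sin t)\<^sup>2 = 1 - (cos t)\<^sup>2" "(sin p)\<^sup>2 = 1 - (cos p)\<^sup>2" by (simp_all add: sin_squared_eq)
  have "e_theta z \<bullet> e_theta z = 1"
    unfolding Pair e_theta_def
    apply (simp add: inner_vec_def sum_3 axis_def)
    using s by algebra
  then show ?thesis by (simp add: norm_eq_1)
qed

lemma sphere_coords_deriv_t:
  "((\<lambda>t. sphere_coords (t, p)) has_vector_derivative e_theta (t, p)) (at t within S)"
  unfolding sphere_coords_eq e_theta_def
  by (auto intro!: derivative_eq_intros simp: algebra_simps)

lemma sphere_coords_deriv_p:
  "((\<lambda>p. sphere_coords (t, p)) has_vector_derivative sin t *\<^sub>R e_phi p) (at p within S)"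
  unfolding sphere_coords_eq e_phi_def
  by (auto intro!: derivative_eq_intros simp: algebra_simps)

lemma e_theta_deriv_t:
  "((\<lambda>t. e_theta (t, p)) has_vector_derivative - sphere_coords (t, p)) (at t within S)"
  unfolding sphere_coords_eq e_theta_def split
  by (auto intro!: derivative_eq_intros simp: algebra_simps)

lemma e_phi_deriv:
  "(e_phi has_vector_derivative - (sin t *\<^sub>R sphere_coords (t, p) + cos t *\<^sub>R e_theta (t, p))) (at p within S)"
proof -
  have s: "sin t * (sin t * x) + cos t * (cos t * x) = x" for x
    using sin_cos_squared_add[of t] by (simp add: power2_eq_square distrib_right[symmetric] flip: mult.assoc)
  have "- (sin t *\<^sub>R sphere_coords (t, p) + cos t *\<^sub>R e_theta (t, p)) = 
      - sin p *\<^sub>R axis 2 1 - cos p *\<^sub>R axis 1 1"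
    using s[of "cos p"] s[of "sin p"]
    by (simp add: vec_eq_iff forall_3 axis_def e_theta_def algebra_simps)
  then show ?thesis unfolding e_phi_def
    by (auto intro!: derivative_eq_intros)
qed

lemma continuous_on_frame [continuous_intros]:
  "continuous_on S sphere_coords" "continuous_on S e_theta" "continuous_on T e_phi"
proof -
  have *: "sphere_coords = (\<lambda>z. (sin (fst z) * cos (snd z)) *\<^sub>R axis 1 1 + (sin (fst z) * sin (snd z)) *\<^sub>R axis 2 1 + cos (fst z) *\<^sub>R axis 3 1)"
    by (rule ext) (metis sphere_coords_eq prod.collapse)
  show "continuous_on S sphere_coords" unfolding * by (intro continuous_intros)
  show "continuous_on S e_theta" "continuous_on T e_phi"
    unfolding e_theta_def e_phi_def case_prod_unfold by (auto intro!: continuous_intros)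
qed

lemma polar_angle_sphere_coords:
  "t \<in> {0..pi} \<Longrightarrow> polar_angle (sphere_coords (t, p)) = t"
  by (simp add: polar_angle_def inner_axis arccos_cos)

lemma polar_angle_bounds:
  "x \<in> S2 \<Longrightarrow> 0 \<le> polar_angle x" "x \<in> S2 \<Longrightarrow> polar_angle x \<le> pi"
  "x \<in> S2 \<Longrightarrow> cos (polar_angle x) = x $ 3"
proof -
  assume x: "x \<in> S2"
  have "\<bar>x $ 3\<bar> \<le> 1" using component_le_norm_cart[of x 3] x by simp
  then show "0 \<le> polar_angle x" "polar_angle x \<le> pi" "cos (polar_angle x) = x $ 3"
    by (auto simp: polar_angle_def inner_axis intro: arccos_lbound arccos_ubound)
qed

lemma cap_eq: assumes "t \<in> {0..pi}" shows "cap t = {x. cos t \<le> x $ 3} \<inter> S2"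
proof -
  have "polar_angle x \<le> t \<longleftrightarrow> cos t \<le> x $ 3" if "x \<in> S2" for x
    using polar_angle_bounds[OF that] assms cos_inj_pi[of "polar_angle x" t] cos_mono_le_eq[of "polar_angle x" t] by auto
  then show ?thesis using polar_angle_bounds unfolding cap_def by blast
qed

lemma cap_pi: "cap pi = S2"
  unfolding cap_def using polar_angle_bounds by auto

lemma sets_cap_borel_surface: assumes "t \<in> {0..pi}" shows "cap t \<in> sets borel_surface_measure"
  unfolding cap_eq[OF assms]
  by (intro sets_borel_surfaceI borel_closed closed_Collect_le continuous_intros)

lemma sets_cap: "t \<in> {0..pi} \<Longrightarrow> cap t \<in> sets surface_measure"
  by (rule sets_surfaceI[OF sets_cap_borel_surface])

lemma cap_integral:
  fixes f :: "R3 \<Rightarrow> real"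
  assumes f: "continuous_on UNIV f" and t: "t \<in> {0..pi}"
  shows "(LINT x:cap t|surface_measure. f x) =
     integral (cbox (0, 0) (t, 2 * pi)) (\<lambda>z. sin (fst z) * f (sphere_coords z))"
proof -
  have "(LINT x:cap t|surface_measure. f x) =
    (LINT z:rect|lborel. sin (fst z) * (indicator (cap t) (sphere_coords z) * f (sphere_coords z)))"
    by (rule set_integral_sphere_coords) (use t f sets_cap sets_cap_borel_surface in \<open>auto intro: borel_measurable_continuous_onI\<close>)
  also have "\<dots> = (LINT z:cbox (0, 0) (t, 2 * pi)|lborel. sin (fst z) * f (sphere_coords z))"
    unfolding set_lebesgue_integral_def
  proof (rule Bochner_Integration.integral_cong[OF refl])
    fix z :: "real \<times> real"
    obtain u p where z: "z = (u, p)" by (cases z)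
    have "sphere_coords (u, p) \<in> cap t \<longleftrightarrow> u \<le> t" if "u \<in> {0..pi}"
      using sphere_coords_in_S2[of "(u,p)"] polar_angle_sphere_coords[OF that, of p] that 
      by (auto simp: cap_def)
    then show "indicat_real rect z *\<^sub>R (sin (fst z) * (indicat_real (cap t) (sphere_coords z) * f (sphere_coords z))) =
         indicat_real (cbox (0, 0) (t, 2 * pi)) z *\<^sub>R (sin (fst z) * f (sphere_coords z))"
      using t by (auto simp: z rect_def cbox_Pair_eq indicator_def)
  qed
  also have "\<dots> = integral (cbox (0, 0) (t, 2 * pi)) (\<lambda>z. sin (fst z) * f (sphere_coords z))"
  proof (rule set_borel_integral_eq_integral)
    have "continuous_on (cbox (0, 0) (t, 2 * pi)) (\<lambda>z. sin (fst z) * f (sphere_coords z))"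
      by (intro continuous_intros continuous_on_compose2[OF f]) auto
    then show "set_integrable lborel (cbox (0, 0) (t, 2 * pi)) (\<lambda>z. sin (fst z) * f (sphere_coords z))"
      unfolding set_integrable_def by (intro borel_integrable_compact compact_cbox)
  qed
  finally show ?thesis .
qed

text \<open>
  For a tangent field with components \<open>u\<close> along \<open>e_theta\<close> and \<open>v\<close> along \<open>e_phi\<close>, the divergence
  times \<open>sin \<theta>\<close> is \<open>\<partial>\<^sub>\<theta> (u sin \<theta>) + \<partial>\<^sub>\<phi> v\<close>. The second term integrates to zero over a full turn, and
  the first one leaves the flux through the boundary circle, because \<open>sin 0 = 0\<close> removes the pole.
\<close>

lemma cap_divergence:
  assumes X: "X \<in> test_fields" and t: "t \<in> {0..pi}"
  shows "(LINT x:cap t|surface_measure. tangential_div X x) =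
     sin t * integral {0..2 * pi} (\<lambda>p. X (sphere_coords (t, p)) \<bullet> e_theta (t, p))"
proof -
  obtain X' where X': "\<And>x. (X has_derivative blinfun_apply (X' x)) (at x)" "continuous_on UNIV X'"
    and C1: "C1_field X" and tan: "\<And>x. x \<in> S2 \<Longrightarrow> X x \<bullet> x = 0"
    using X unfolding C1_field_def test_fields_def by blast
  have Xc: "continuous_on UNIV X"
    using X'(1) by (meson continuous_at_imp_continuous_on has_derivative_continuous)
  note c = continuous_intros continuous_on_compose2[OF Xc] continuous_on_compose2[OF X'(2)]
     continuous_on_compose2[OF continuous_on_frame(3)[of UNIV]]
  define A where "A z = cos (fst z) * (X (sphere_coords z) \<bullet> e_theta z)
     + sin (fst z) * (X' (sphere_coords z) (e_theta z) \<bullet> e_theta z)" for z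
  define B where "B z = sin (fst z) * (X' (sphere_coords z) (e_phi (snd z)) \<bullet> e_phi (snd z))
     - cos (fst z) * (X (sphere_coords z) \<bullet> e_theta z)" for z
  have XS: "X (sphere_coords z) \<bullet> sphere_coords z = 0" for z
    by (rule tan[OF sphere_coords_in_S2])
  have split: "sin (fst z) * tangential_div X (sphere_coords z) = A z + B z" for z
  proof (cases z)
    case (Pair u p)
    show ?thesis
      unfolding Pair tangential_div_eq[OF X'(1)]
      by (subst orthonormal_frame_trace) (auto simp: A_def B_def blinfun.bounded_linear_right algebra_simps)
  qed
  have Ac: "continuous_on S A" and Bc: "continuous_on S B" for S
    unfolding A_def B_def by (auto intro!: c)
  have A': "((\<lambda>u. sin u * (X (sphere_coords (u, p)) \<bullet> e_theta (u, p))) has_vector_derivative A (u, p)) (at u within S)" for u p S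
  proof -
    have "((\<lambda>u. X (sphere_coords (u, p))) has_vector_derivative X' (sphere_coords (u, p)) (e_theta (u, p))) (at u within S)"
      by (rule vector_derivative_diff_chain_within[OF sphere_coords_deriv_t, unfolded o_def])
         (rule has_derivative_at_withinI[OF X'(1)])
    from bounded_bilinear.has_vector_derivative[OF bounded_bilinear_inner this e_theta_deriv_t[of p u S]]
    have "((\<lambda>u. X (sphere_coords (u, p)) \<bullet> e_theta (u, p)) has_vector_derivative
       X' (sphere_coords (u, p)) (e_theta (u, p)) \<bullet> e_theta (u, p)) (at u within S)"
      by (simp add: XS add.commute)
    then show ?thesis unfolding A_def
      by (auto intro!: derivative_eq_intros simp: has_real_derivative_iff_has_vector_derivative[symmetric])
  qed
  have B': "((\<lambda>p. X (sphere_coords (u, p)) \<bullet> e_phi p) has_vector_derivative B (u, p)) (at p within S)" for u p S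
  proof -
    have "((\<lambda>p. X (sphere_coords (u, p))) has_vector_derivative X' (sphere_coords (u, p)) (sin u *\<^sub>R e_phi p)) (at p within S)"
      by (rule vector_derivative_diff_chain_within[OF sphere_coords_deriv_p, unfolded o_def])
         (rule has_derivative_at_withinI[OF X'(1)])
    from bounded_bilinear.has_vector_derivative[OF bounded_bilinear_inner this e_phi_deriv[of u p S]]
    show ?thesis unfolding B_def
      by (simp add: XS inner_add_right blinfun.scaleR_right algebra_simps)
  qed
  have IA: "integral {0..t} (\<lambda>u. A (u, p)) = sin t * (X (sphere_coords (t, p)) \<bullet> e_theta (t, p))" for p
    using fundamental_theorem_of_calculus[OF _ A', of 0 t p] t by (intro integral_unique) auto
  have IB: "integral {0..2 * pi} (\<lambda>p. B (u, p)) = 0" for u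
  proof -
    have "sphere_coords (u, 2 * pi) = sphere_coords (u, 0)" "e_phi (2 * pi) = e_phi 0"
      by (simp_all add: sphere_coords_eq e_phi_def)
    then show ?thesis
      using fundamental_theorem_of_calculus[OF _ B', of 0 "2 * pi" u] by (intro integral_unique) auto
  qed
  have "(LINT x:cap t|surface_measure. tangential_div X x) =
     integral (cbox (0, 0) (t, 2 * pi)) (\<lambda>z. A z + B z)"
    unfolding cap_integral[OF continuous_tangential_div[OF C1] t] split ..
  also have "\<dots> = integral (cbox (0, 0) (t, 2 * pi)) A + integral (cbox (0, 0) (t, 2 * pi)) B"
    by (intro integral_add integrable_continuous Ac Bc)
  also have "integral (cbox (0, 0) (t, 2 * pi)) B = integral (cbox 0 t) (\<lambda>u. integral (cbox 0 (2 * pi)) (\<lambda>p. B (u, p)))"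
    by (rule integral_prod_continuous[OF Bc])
  also have "\<dots> = 0" by (simp add: IB)
  also have "integral (cbox (0, 0) (t, 2 * pi)) A = integral (cbox 0 t) (\<lambda>u. integral (cbox 0 (2 * pi)) (\<lambda>p. A (u, p)))"
    by (rule integral_prod_continuous[OF Ac])
  also have "\<dots> = integral (cbox 0 (2 * pi)) (\<lambda>p. integral (cbox 0 t) (\<lambda>u. A (u, p)))"
    by (rule integral_swap_continuous) (simp add: Ac)
  also have "\<dots> = sin t * integral {0..2 * pi} (\<lambda>p. X (sphere_coords (t, p)) \<bullet> e_theta (t, p))"
    by (simp add: IA)
  finally show ?thesis by simp
qed

section \<open>Meridional test fields and the perimeter of caps\<close>

text \<open>The vector \<open>x\<^sub>3 x - e\<^sub>3\<close> is minus the tangential gradient of the height, hence points along meridians away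
  from the north pole and has length \<open>sin \<theta>\<close>.\<close>

definition meridional_field :: "(R3 \<Rightarrow> real) \<Rightarrow> R3 \<Rightarrow> R3" where
  "meridional_field \<phi> x = \<phi> x *\<^sub>R (x $ 3 *\<^sub>R x - e3)"

lemma meridional_norm: "x \<in> S2 \<Longrightarrow> norm (meridional_field \<phi> x) = \<bar>\<phi> x\<bar> * sqrt (1 - (x $ 3)\<^sup>2)"
proof -
  assume x: "x \<in> S2"
  have "(norm (x $ 3 *\<^sub>R x - e3))\<^sup>2 = 1 - (x $ 3)\<^sup>2"
  proof -
    have "x \<bullet> x = 1" using x by (simp add: norm_eq_1)
    then show ?thesis
      unfolding power2_norm_eq_inner
      by (simp add: inner_diff_left inner_diff_right inner_axis inner_axis' power2_eq_square)
  qed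
  then have "norm (x $ 3 *\<^sub>R x - e3) = sqrt (1 - (x $ 3)\<^sup>2)"
    by (metis norm_ge_zero real_sqrt_unique)
  then show ?thesis by (simp add: meridional_field_def)
qed

lemma meridional_field_properties:
  assumes \<phi>: "\<And>x. (\<phi> has_derivative (\<lambda>h. g x \<bullet> h)) (at x)" and g: "continuous_on UNIV g"
    and bound: "\<And>x. x \<in> S2 \<Longrightarrow> \<bar>\<phi> x\<bar> * sqrt (1 - (x $ 3)\<^sup>2) \<le> 1"
  shows "meridional_field \<phi> \<in> test_fields"
    and "x \<in> S2 \<Longrightarrow> tangential_div (meridional_field \<phi>) x = g x \<bullet> (x $ 3 *\<^sub>R x - e3) + 2 * \<phi> x * x $ 3"
proof -
  define D where "D x h = (g x \<bullet> h) *\<^sub>R (x $ 3 *\<^sub>R x - e3) + \<phi> x *\<^sub>R (h $ 3 *\<^sub>R x + x $ 3 *\<^sub>R h)" for x h :: R3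
  have nth: "((\<lambda>x::R3. x $ 3) has_derivative (\<lambda>h. h $ 3)) (at x)" for x
    by (rule bounded_linear_imp_has_derivative) (rule bounded_linear_vec_nth)
  have D: "(meridional_field \<phi> has_derivative D x) (at x)" for x
    unfolding meridional_field_def[abs_def] D_def
    by (auto intro!: derivative_eq_intros \<phi> nth simp: algebra_simps)
  have "continuous_on UNIV \<phi>"
    using \<phi> by (meson continuous_at_imp_continuous_on has_derivative_continuous)
  then have "C1_field (meridional_field \<phi>)"
    by (intro C1_fieldI[OF D]) (auto simp: D_def intro!: continuous_intros g)
  moreover have "meridional_field \<phi> x \<bullet> x = 0" if "x \<in> S2" for x
  proof -
    have "x \<bullet> x = 1" using that by (simp add: norm_eq_1)
    then show ?thesis
      by (simp add: meridional_field_def inner_diff_left inner_axis inner_axis')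
  qed
  ultimately show "meridional_field \<phi> \<in> test_fields"
    using bound by (simp add: test_fields_def meridional_norm)
  show "tangential_div (meridional_field \<phi>) x = g x \<bullet> (x $ 3 *\<^sub>R x - e3) + 2 * \<phi> x * x $ 3" if "x \<in> S2"
  proof -
    have "x \<bullet> x = 1" using that by (simp add: norm_eq_1)
    then have s: "x $ 1 * x $ 1 + x $ 2 * x $ 2 + x $ 3 * x $ 3 = 1"
      by (simp add: inner_vec_def sum_3)
    show ?thesis
      unfolding tangential_div_eq[OF D] sum_Basis_R3 D_def
      apply (simp add: axis_def inner_vec_def sum_3)
      using s by algebra
  qed
qed

abbreviation height_integral :: "R3 set \<Rightarrow> real" where
  "height_integral F \<equiv> (LINT x:F|surface_measure. x $ 3)"

abbreviation real_perimeter :: "R3 set \<Rightarrow> real" where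
  "real_perimeter F \<equiv> real_of_ereal (perimeter F)"

lemma perimeter_upper:
  "X \<in> test_fields \<Longrightarrow> ereal (LINT x:F|surface_measure. tangential_div X x) \<le> perimeter F"
  unfolding perimeter_def by (rule SUP_upper)

lemma zero_test_field: "(\<lambda>x. 0) \<in> test_fields"
  unfolding test_fields_def by (auto intro!: C1_fieldI[where D="\<lambda>_ _. 0"])

lemma tangential_div_zero: "tangential_div (\<lambda>x. 0) x = 0"
  by (subst tangential_div_eq[where D="\<lambda>_. 0"]) auto

lemma perimeter_nonneg: "0 \<le> perimeter F"
  using perimeter_upper[OF zero_test_field, of F] by (simp add: tangential_div_zero zero_ereal_def)

lemma real_perimeter_nonneg: "0 \<le> real_perimeter F"
  using perimeter_nonneg by (rule real_of_ereal_pos)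

lemma real_perimeter_upper:
  assumes "finite_perimeter F" "X \<in> test_fields"
  shows "(LINT x:F|surface_measure. tangential_div X x) \<le> real_perimeter F"
proof -
  have "ereal (real_perimeter F) = perimeter F"
    using assms(1) perimeter_nonneg[of F] unfolding finite_perimeter_def
    by (intro ereal_real') auto
  then show ?thesis using perimeter_upper[OF assms(2), of F] by (metis ereal_less_eq(3))
qed

lemma surface_set_integral_cong:
  assumes "F \<in> sets surface_measure" "\<And>x. x \<in> S2 \<Longrightarrow> f x = (g x :: real)"
  shows "(LINT x:F|surface_measure. f x) = (LINT x:F|surface_measure. g x)"
  using assms surface_subset[OF assms(1)] by (intro set_lebesgue_integral_cong) auto

lemma continuous_nth3 [continuous_intros]: "continuous_on S (\<lambda>x::R3. x $ 3)"
  by (intro continuous_intros)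

text \<open>
  Admissible perturbations of the calibration: with \<open>y = z\<^sup>2\<close>, the factor is at most \<open>1 + y / 4\<close> and the length
  of the meridional vector is \<open>\<surd>(1 - y) \<le> 1 - y / 2\<close>. The exponent is at least 2 so that the
  perturbation is dominated by this slack, which is of second order at the equator.
\<close>

lemma power_field:
  fixes n :: nat and e :: real
  assumes "\<bar>e\<bar> \<le> 1 / 4"
  defines "X \<equiv> meridional_field (\<lambda>x. 1 + e * (x $ 3) ^ (n + 2))"
  shows "X \<in> test_fields"
    and "x \<in> S2 \<Longrightarrow> tangential_div X x = 2 * x $ 3 + e * ((real n + 4) * (x $ 3) ^ (n + 3) - (real n + 2) * (x $ 3) ^ (n + 1))"
proof -
  define g :: "R3 \<Rightarrow> R3" where "g x = axis 3 (e * (real n + 2) * (x $ 3) ^ (n + 1))" for x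
  have nth: "((\<lambda>x::R3. x $ 3) has_derivative (\<lambda>h. h $ 3)) (at x)" for x
    by (rule bounded_linear_imp_has_derivative) (rule bounded_linear_vec_nth)
  have d: "((\<lambda>x::R3. 1 + e * (x $ 3) ^ (n + 2)) has_derivative (\<lambda>h. g x \<bullet> h)) (at x)" for x
    by (rule derivative_eq_intros nth refl)+ (simp add: g_def inner_axis' fun_eq_iff algebra_simps)
  have gc: "continuous_on UNIV g"
  proof -
    have "g = (\<lambda>x. (e * (real n + 2) * (x $ 3) ^ (n + 1)) *\<^sub>R e3)"
      by (auto simp: g_def vec_eq_iff axis_def)
    then show ?thesis by (auto intro!: continuous_intros)
  qed
  have bound: "\<bar>1 + e * (x $ 3) ^ (n + 2)\<bar> * sqrt (1 - (x $ 3)\<^sup>2) \<le> 1" if "x \<in> S2" for x :: R3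
  proof -
    define y where "y = (x $ 3)\<^sup>2"
    have z: "\<bar>x $ 3\<bar> \<le> 1" using component_le_norm_cart[of x 3] that by simp
    then have y: "0 \<le> y" "y \<le> 1" by (auto simp: y_def abs_square_le_1)
    have "\<bar>(x $ 3) ^ n\<bar> * y \<le> 1 * y"
      using z y by (intro mult_right_mono) (auto simp: power_abs power_le_one)
    then have "\<bar>(x $ 3) ^ (n + 2)\<bar> \<le> y"
      unfolding power_add abs_mult y_def by simp
    then have "\<bar>e * (x $ 3) ^ (n + 2)\<bar> \<le> 1 / 4 * y"
      unfolding abs_mult using assms by (intro mult_mono) auto
    then have 1: "\<bar>1 + e * (x $ 3) ^ (n + 2)\<bar> \<le> 1 + y / 4" by linarith
    have "sqrt (1 - y) \<le> 1 - y / 2"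
      using y by (intro real_le_lsqrt) (auto simp: power2_eq_square algebra_simps)
    then have "\<bar>1 + e * (x $ 3) ^ (n + 2)\<bar> * sqrt (1 - y) \<le> (1 + y / 4) * (1 - y / 2)"
      using 1 y by (intro mult_mono) auto
    also have "\<dots> \<le> 1" using y by (simp add: algebra_simps)
    finally show ?thesis unfolding y_def .
  qed
  show "X \<in> test_fields"
    unfolding X_def by (rule meridional_field_properties(1)[OF d gc bound])
  show "x \<in> S2 \<Longrightarrow> tangential_div X x = 2 * x $ 3 + e * ((real n + 4) * (x $ 3) ^ (n + 3) - (real n + 2) * (x $ 3) ^ (n + 1))"
    unfolding X_def
    by (subst meridional_field_properties(2)[OF d gc bound])
       (auto simp: g_def inner_axis' algebra_simps power_add eval_nat_numeral)
qed

lemma height_field: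
  assumes "\<bar>c\<bar> \<le> 1"
  shows "meridional_field (\<lambda>_. c) \<in> test_fields"
    and "x \<in> S2 \<Longrightarrow> tangential_div (meridional_field (\<lambda>_. c)) x = c * (2 * x $ 3)"
proof -
  have d: "((\<lambda>_. c) has_derivative (\<lambda>h. (0::R3) \<bullet> h)) (at x)" for x :: R3
    by simp
  have bound: "\<bar>c\<bar> * sqrt (1 - (x $ 3)\<^sup>2) \<le> 1" if "x \<in> S2" for x :: R3
  proof -
    have "sqrt (1 - (x $ 3)\<^sup>2) \<le> 1" by simp
    moreover have "(x $ 3)\<^sup>2 \<le> 1" using component_le_norm_cart[of x 3] that by (simp add: abs_square_le_1)
    ultimately have "\<bar>c\<bar> * sqrt (1 - (x $ 3)\<^sup>2) \<le> 1 * 1"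
      using assms by (intro mult_mono) auto
    then show ?thesis by simp
  qed
  note p = meridional_field_properties[OF d continuous_on_const bound]
  show "meridional_field (\<lambda>_. c) \<in> test_fields" by (rule p)
  show "x \<in> S2 \<Longrightarrow> tangential_div (meridional_field (\<lambda>_. c)) x = c * (2 * x $ 3)"
    by (subst p) auto
qed

text \<open>The calibration inequality, with both signs of the field.\<close>

lemma height_integral_le_half_perimeter:
  assumes "finite_perimeter F"
  shows "2 * \<bar>height_integral F\<bar> \<le> real_perimeter F"
proof -
  have F: "F \<in> sets surface_measure" using assms by (simp add: finite_perimeter_def)
  have "c * (2 * height_integral F) \<le> real_perimeter F" if "\<bar>c\<bar> \<le> 1" for c
  proof -
    have "(LINT x:F|surface_measure. tangential_div (meridional_field (\<lambda>_. c)) x) = (LINT x:F|surface_measure. c * (2 * x $ 3))"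
      by (rule surface_set_integral_cong[OF F height_field(2)[OF that]])
    then show ?thesis
      using real_perimeter_upper[OF assms height_field(1)[OF that]] by simp
  qed
  from this[of 1] this[of "-1"] show ?thesis by simp
qed

text \<open>
  A calibration of the parallel circle of radius \<open>1 / a\<close>: with \<open>r = sin \<theta>\<close>, the length of the
  field is \<open>2 a r / (1 + (a r)\<^sup>2) \<le> 1\<close>, with equality exactly for \<open>a r = 1\<close>. Writing \<open>r\<^sup>2\<close> as
  \<open>x\<^sub>1\<^sup>2 + x\<^sub>2\<^sup>2\<close>, rather than \<open>1 - x\<^sub>3\<^sup>2\<close>, keeps the denominator positive on the whole space.
\<close>

lemma cap_field:
  fixes a :: real
  assumes "a > 0"
  defines "\<phi> \<equiv> \<lambda>x::R3. 2 * a / (1 + a\<^sup>2 * ((x $ 1)\<^sup>2 + (x $ 2)\<^sup>2))"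
  shows "meridional_field \<phi> \<in> test_fields"
proof -
  define q where "q x = 1 + a\<^sup>2 * ((x $ 1)\<^sup>2 + (x $ 2)\<^sup>2)" for x :: R3
  have q: "q x > 0" for x unfolding q_def by (intro add_pos_nonneg) auto
  define g :: "R3 \<Rightarrow> R3" where "g x = (- (4 * a ^ 3) / (q x)\<^sup>2) *\<^sub>R (x $ 1 *\<^sub>R axis 1 1 + x $ 2 *\<^sub>R axis 2 1)" for x
  have nth: "((\<lambda>x::R3. x $ i) has_derivative (\<lambda>h. h $ i)) (at x)" for x i
    by (rule bounded_linear_imp_has_derivative) (rule bounded_linear_vec_nth)
  have qd: "(q has_derivative (\<lambda>h. a\<^sup>2 * (2 * (x $ 1) * h $ 1 + 2 * x $ 2 * h $ 2))) (at x)" for x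
    unfolding q_def[abs_def] by (rule derivative_eq_intros nth refl)+ (simp add: fun_eq_iff algebra_simps)
  have \<phi>q: "\<phi> = (\<lambda>x. 2 * a / q x)" by (simp add: \<phi>_def q_def)
  have gi: "g x \<bullet> h = - (4 * a ^ 3) / (q x)\<^sup>2 * (x $ 1 * h $ 1 + x $ 2 * h $ 2)" for x h
    by (simp add: g_def inner_axis' inner_add_left)
  have d: "(\<phi> has_derivative (\<lambda>h. g x \<bullet> h)) (at x)" for x
    unfolding \<phi>q gi
    by (rule derivative_eq_intros qd refl)+
       (use q[of x] in \<open>auto simp: fun_eq_iff field_simps power2_eq_square eval_nat_numeral\<close>)
  have qc: "continuous_on UNIV q" unfolding q_def by (intro continuous_intros)
  have gc: "continuous_on UNIV g"
    unfolding g_def using q by (intro continuous_intros qc) (auto simp: less_imp_neq[THEN not_sym])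
  have "\<bar>\<phi> x\<bar> * sqrt (1 - (x $ 3)\<^sup>2) \<le> 1" if "x \<in> S2" for x
  proof -
    define y where "y = sqrt ((x $ 1)\<^sup>2 + (x $ 2)\<^sup>2)"
    have "x \<bullet> x = 1" using that by (simp add: norm_eq_1)
    then have "1 - (x $ 3)\<^sup>2 = (x $ 1)\<^sup>2 + (x $ 2)\<^sup>2"
      by (simp add: inner_vec_def sum_3 power2_eq_square)
    moreover have "q x = 1 + (a * y)\<^sup>2" by (simp add: q_def y_def power_mult_distrib)
    moreover have "2 * (a * y) \<le> 1 + (a * y)\<^sup>2"
      using sum_squares_ge_zero[of "a * y - 1" 0] by (simp add: power2_eq_square algebra_simps)
    ultimately show ?thesis
      using q[of x] assms(1) unfolding \<phi>q by (simp add: y_def[symmetric] divide_simps mult_ac)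
  qed
  then show ?thesis by (rule meridional_field_properties(1)[OF d gc])
qed

lemma perimeter_cap:
  assumes t: "t \<in> {0..pi}"
  shows "perimeter (cap t) = ereal (2 * pi * sin t)"
proof (rule antisym)
  show "perimeter (cap t) \<le> ereal (2 * pi * sin t)"
    unfolding perimeter_def
  proof (rule SUP_least)
    fix X assume X: "X \<in> test_fields"
    then have "C1_field X" and n: "\<And>x. x \<in> S2 \<Longrightarrow> norm (X x) \<le> 1" by (auto simp: test_fields_def)
    then have Xc: "continuous_on UNIV X"
      unfolding C1_field_def by (meson continuous_at_imp_continuous_on has_derivative_continuous)
    have "integral {0..2 * pi} (\<lambda>p. X (sphere_coords (t, p)) \<bullet> e_theta (t, p)) \<le> integral {0..2 * pi} (\<lambda>p. 1)"
    proof (rule integral_le)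
      show "(\<lambda>p. X (sphere_coords (t, p)) \<bullet> e_theta (t, p)) integrable_on {0..2 * pi}"
        by (intro integrable_continuous_interval continuous_intros continuous_on_compose2[OF Xc]
          continuous_on_compose2[OF continuous_on_frame(1)[of UNIV]]
          continuous_on_compose2[OF continuous_on_frame(2)[of UNIV]]) auto
      show "X (sphere_coords (t, p)) \<bullet> e_theta (t, p) \<le> 1" for p
      proof -
        have "X (sphere_coords (t, p)) \<bullet> e_theta (t, p) \<le> norm (X (sphere_coords (t, p))) * norm (e_theta (t, p))"
          by (rule norm_cauchy_schwarz)
        then show ?thesis using n[OF sphere_coords_in_S2, of "(t, p)"] by (simp add: norm_e_theta)
      qed
    qed (auto intro: integrable_const_ivl)
    also have "\<dots> = 2 * pi" by simp
    finally have "sin t * integral {0..2 * pi} (\<lambda>p. X (sphere_coords (t, p)) \<bullet> e_theta (t, p)) \<le> sin t * (2 * pi)"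
      using t by (intro mult_left_mono sin_ge_zero) auto
    then show "ereal (LINT x:cap t|surface_measure. tangential_div X x) \<le> ereal (2 * pi * sin t)"
      by (simp add: cap_divergence[OF X t] mult_ac)
  qed
next
  show "ereal (2 * pi * sin t) \<le> perimeter (cap t)"
  proof (cases "sin t = 0")
    case True then show ?thesis by (simp add: perimeter_nonneg zero_ereal_def[symmetric])
  next
    case False
    then have s: "sin t > 0" using t by (simp add: less_le sin_ge_zero)
    define a where "a = 1 / sin t"
    define \<phi> where "\<phi> = (\<lambda>x::R3. 2 * a / (1 + a\<^sup>2 * ((x $ 1)\<^sup>2 + (x $ 2)\<^sup>2)))"
    have X: "meridional_field \<phi> \<in> test_fields"
      unfolding \<phi>_def by (rule cap_field) (simp add: a_def s)
    have "meridional_field \<phi> (sphere_coords (t, p)) \<bullet> e_theta (t, p) = 1" for p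
    proof -
      have "(sin t * cos p)\<^sup>2 + (sin t * sin p)\<^sup>2 = (sin t)\<^sup>2"
        by (simp add: power_mult_distrib distrib_left[symmetric])
      then have "\<phi> (sphere_coords (t, p)) = a"
        using s by (simp add: \<phi>_def a_def power_divide)
      moreover have "(cos t *\<^sub>R sphere_coords (t, p) - e3) \<bullet> e_theta (t, p) = sin t"
      proof -
        have "sphere_coords (t, p) \<bullet> e_theta (t, p) = 0"
        proof -
          have s: "(sin p)\<^sup>2 = 1 - (cos p)\<^sup>2" by (simp add: sin_squared_eq)
          show ?thesis
            apply (simp add: e_theta_def sphere_coords_eq inner_vec_def sum_3 axis_def)
            using s by algebra
        qed
        moreover have "e3 \<bullet> e_theta (t, p) = - sin t"
          by (simp add: e_theta_def inner_vec_def sum_3 axis_def)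
        ultimately show ?thesis by (simp add: inner_diff_left)
      qed
      ultimately show ?thesis using s by (simp add: meridional_field_def a_def)
    qed
    then have "(LINT x:cap t|surface_measure. tangential_div (meridional_field \<phi>) x) = 2 * pi * sin t"
      by (simp add: cap_divergence[OF X t])
    then show ?thesis using perimeter_upper[OF X, of "cap t"] by simp
  qed
qed

lemma finite_perimeter_cap: "t \<in> {0..pi} \<Longrightarrow> finite_perimeter (cap t)"
  by (simp add: finite_perimeter_def sets_cap perimeter_cap)

section \<open>Recovering a step function from its cosine moments\<close>

lemma set_integrable_bounded_Icc:
  fixes f :: "real \<Rightarrow> real"
  assumes "f \<in> borel_measurable borel" "\<And>t. t \<in> {a..b} \<Longrightarrow> \<bar>f t\<bar> \<le> C"
  shows "set_integrable lborel {a..b} f"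
  unfolding set_integrable_def
  by (rule integrableI_bounded_set_indicator[where B=C]) (use assms emeasure_lborel_cbox_finite[of a b] in auto)

text \<open>The cosine is injective on \<open>[0, \<pi>]\<close>, so by the Weierstrass theorem, applied to \<open>g \<circ> arccos\<close>, polynomials
  in it approximate every continuous \<open>g\<close> uniformly there.\<close>

lemma orthogonal_to_cos_powers_imp_continuous:
  fixes f :: "real \<Rightarrow> real"
  assumes f: "f \<in> borel_measurable borel" "\<And>t. \<bar>f t\<bar> \<le> C"
    and orth: "\<And>n::nat. (LINT t:{0..pi}|lborel. f t * cos t ^ n) = 0"
    and g: "continuous_on UNIV g"
  shows "(LINT t:{0..pi}|lborel. f t * g t) = 0"
proof -
  have C: "0 \<le> C" using f(2)[of 0] by linarith
  have cont_arccos: "continuous_on {-1..1} (\<lambda>z. g (arccos z))"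
    by (intro continuous_on_compose2[OF g] continuous_on_arccos continuous_intros) auto
  have meas: "(\<lambda>t. f t * h t) \<in> borel_measurable borel" if "continuous_on UNIV h" for h
    using f(1) borel_measurable_continuous_onI[OF that] by measurable
  have int: "set_integrable lborel {0..pi} (\<lambda>t. f t * h t)" if "continuous_on UNIV h" for h :: "real \<Rightarrow> real"
  proof -
    have "compact (h ` {0..pi})"
      by (intro compact_continuous_image continuous_on_subset[OF that]) auto
    then have "bounded (h ` {0..pi})" by (rule compact_imp_bounded)
    then obtain B where "\<forall>y\<in>h ` {0..pi}. norm y \<le> B" unfolding bounded_iff ..
    then have B: "\<bar>h x\<bar> \<le> B" if "x \<in> {0..pi}" for x using that by fastforce
    show ?thesis
      by (rule set_integrable_bounded_Icc[where C="C*B"])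
        (use meas[OF that] B f(2) C in \<open>auto simp: abs_mult intro!: mult_mono\<close>)
  qed
  have poly: "(LINT t:{0..pi}|lborel. f t * p (cos t)) = 0" if p: "real_polynomial_function p" for p
  proof -
    obtain a n where p: "p = (\<lambda>x. \<Sum>i\<le>n. a i * x ^ i)"
      using p by (auto simp: real_polynomial_function_iff_sum)
    have "(LINT t:{0..pi}|lborel. f t * p (cos t)) = (LINT t:{0..pi}|lborel. (\<Sum>i\<le>n. a i * (f t * cos t ^ i)))"
      unfolding p by (simp add: sum_distrib_left mult_ac)
    also have "\<dots> = (\<Sum>i\<le>n. LINT t:{0..pi}|lborel. a i * (f t * cos t ^ i))"
      unfolding set_lebesgue_integral_def scaleR_sum_right
      by (intro Bochner_Integration.integral_sum set_integrable_mult_right[unfolded set_integrable_def]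
          int[unfolded set_integrable_def] continuous_intros)
    also have "\<dots> = 0" by (simp add: orth)
    finally show ?thesis .
  qed
  have "\<bar>LINT t:{0..pi}|lborel. f t * g t\<bar> \<le> e" if "e > 0" for e
  proof -
    define d where "d = e / (C * pi + 1)"
    have Cpi: "C * pi \<ge> 0" using C by simp
    have d: "d > 0" using that Cpi unfolding d_def by simp
    obtain p where p: "real_polynomial_function p" "\<And>z. z \<in> {-1..1} \<Longrightarrow> \<bar>g (arccos z) - p z\<bar> < d"
      using Stone_Weierstrass_real_polynomial_function[OF compact_Icc cont_arccos d] by blast
    have pc: "continuous_on UNIV (\<lambda>t. p (cos t))"
    proof -
      have "continuous_on UNIV p"
        using p(1) by (simp add: continuous_on_polymonial_function real_polynomial_function_eq)
      from continuous_on_compose2[OF this continuous_on_cos[OF continuous_on_id[of UNIV]]] show ?thesis by simp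
    qed
    have gp: "\<bar>g t - p (cos t)\<bar> \<le> d" if "t \<in> {0..pi}" for t
      using p(2)[of "cos t"] that by (auto simp: arccos_cos)
    have "(LINT t:{0..pi}|lborel. f t * g t) = (LINT t:{0..pi}|lborel. f t * g t) - (LINT t:{0..pi}|lborel. f t * p (cos t))"
      by (simp add: poly p)
    also have "\<dots> = (LINT t:{0..pi}|lborel. f t * g t - f t * p (cos t))"
      by (intro set_integral_diff(2)[symmetric] int g pc)
    finally have eq: "(LINT t:{0..pi}|lborel. f t * g t) = (LINT t:{0..pi}|lborel. f t * g t - f t * p (cos t))" .
    have "\<bar>LINT t:{0..pi}|lborel. f t * g t\<bar> \<le> (LINT t:{0..pi}|lborel. \<bar>f t * g t - f t * p (cos t)\<bar>)"
      unfolding eq real_norm_def[symmetric] by (intro set_integral_norm_bound set_integral_diff(1) int g pc)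
    also have "\<dots> \<le> (LINT t:{0..pi}|lborel. C * d)"
    proof (rule set_integral_mono)
      show "set_integrable lborel {0..pi} (\<lambda>t. \<bar>f t * g t - f t * p (cos t)\<bar>)"
        by (intro set_integrable_abs set_integral_diff(1) int g pc)
      show "set_integrable lborel {0..pi} (\<lambda>t. C * d)"
        by (rule set_integrable_bounded_Icc[where C="C*d"]) (use C d in auto)
      show "\<bar>f t * g t - f t * p (cos t)\<bar> \<le> C * d" if "t \<in> {0..pi}" for t
        using f(2)[of t] gp[OF that] C by (auto simp: abs_mult right_diff_distrib[symmetric] intro!: mult_mono)
    qed
    also have "\<dots> = C * pi * d"
      by (simp add: set_lebesgue_integral_def)
    also have "\<dots> \<le> e"
      using that Cpi unfolding d_def by (simp add: divide_simps)
    finally show ?thesis .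
  qed
  then show ?thesis
    by (metis abs_le_zero_iff field_le_epsilon add_0)
qed

text \<open>A bounded measurable function is an almost everywhere limit of continuous functions with the same
  bound; testing \<open>f\<close> with these gives \<open>\<integral> f\<^sup>2 = 0\<close>.\<close>

lemma orthogonal_to_cos_powers_imp_zero:
  fixes f :: "real \<Rightarrow> real"
  assumes f: "f \<in> borel_measurable borel" "\<And>t. \<bar>f t\<bar> \<le> C"
    and orth: "\<And>n::nat. (LINT t:{0..pi}|lborel. f t * cos t ^ n) = 0"
  shows "AE t in lborel. t \<in> {0..pi} \<longrightarrow> f t = 0"
proof -
  have C: "0 \<le> C" using f(2)[of 0] by linarith
  have "f measurable_on UNIV"
    using f(1) by (simp add: measurable_on_iff_borel_measurable lebesgue_on_UNIV_eq measurable_completion)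
  then obtain N g where N: "negligible N" and gc: "\<And>n. continuous_on UNIV (g n)"
    and lim: "\<And>x. x \<notin> N \<Longrightarrow> (\<lambda>n. g n x) \<longlonglongrightarrow> f x"
    unfolding measurable_on_def by auto
  define h where "h n x = max (- C) (min C (g n x))" for n x
  have hc: "continuous_on UNIV (h n)" for n
    unfolding h_def by (intro continuous_intros gc)
  have hC: "\<bar>h n x\<bar> \<le> C" for n x using C by (auto simp: h_def)
  have hlim: "(\<lambda>n. h n x) \<longlonglongrightarrow> f x" if "x \<notin> N" for x
  proof -
    have "(\<lambda>n. max (- C) (min C (g n x))) \<longlonglongrightarrow> max (- C) (min C (f x))"
      by (intro tendsto_intros lim that)
    moreover have "max (- C) (min C (f x)) = f x" using f(2)[of x] by auto
    ultimately show ?thesis by (simp add: h_def)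
  qed
  have hm [measurable]: "h n \<in> borel_measurable borel" for n
    by (intro borel_measurable_continuous_onI hc)
  note f(1)[measurable]
  have aeN: "AE x in lborel. x \<notin> N"
    using N AE_not_in[of N lebesgue] unfolding negligible_iff_null_sets AE_completion_iff by simp
  have "(\<lambda>n. LINT t:{0..pi}|lborel. f t * h n t) \<longlonglongrightarrow> (LINT t:{0..pi}|lborel. f t * f t)"
    unfolding set_lebesgue_integral_def
  proof (rule integral_dominated_convergence[where w="\<lambda>t. indicator {0..pi} t *\<^sub>R (C * C)"])
    show "integrable lborel (\<lambda>t. indicat_real {0..pi} t *\<^sub>R (C * C))"
      using set_integrable_bounded_Icc[of "\<lambda>_. C * C" 0 pi "C*C"] C by (simp add: set_integrable_def)
    show "AE x in lborel. (\<lambda>i. indicat_real {0..pi} x *\<^sub>R (f x * h i x)) \<longlonglongrightarrow> indicat_real {0..pi} x *\<^sub>R (f x * f x)"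
      using aeN by eventually_elim (intro tendsto_intros hlim)
    show "AE x in lborel. norm (indicat_real {0..pi} x *\<^sub>R (f x * h i x)) \<le> indicat_real {0..pi} x *\<^sub>R (C * C)" for i
      using hC f(2) C by (auto simp: abs_mult indicator_def intro!: mult_mono AE_I2)
  qed measurable
  moreover have "(LINT t:{0..pi}|lborel. f t * h n t) = 0" for n
    by (rule orthogonal_to_cos_powers_imp_continuous[OF f orth hc])
  ultimately have "(LINT t:{0..pi}|lborel. f t * f t) = 0"
    by (simp add: LIMSEQ_const_iff)
  moreover have "set_integrable lborel {0..pi} (\<lambda>t. f t * f t)"
  proof (rule set_integrable_bounded_Icc[where C="C*C"])
    show "\<bar>f t * f t\<bar> \<le> C * C" for t
      using mult_mono[OF f(2)[of t] f(2)[of t]] C by (simp add: abs_mult)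
  qed measurable
  ultimately have "AE t in lborel. indicat_real {0..pi} t *\<^sub>R (f t * f t) = 0"
    unfolding set_lebesgue_integral_def set_integrable_def
    using integral_nonneg_eq_0_iff_AE[of lborel "\<lambda>t. indicat_real {0..pi} t *\<^sub>R (f t * f t)"] by simp
  then show ?thesis by eventually_elim (auto simp: indicator_def split: if_splits)
qed

lemma integral_cos_power_sin:
  assumes "a \<le> b"
  shows "(LINT t:{a..b}|lborel. cos t ^ n * sin t) = (cos a ^ Suc n - cos b ^ Suc n) / Suc n"
proof -
  have "(LINT t:{a..b}|lborel. cos t ^ n * sin t) = 
    (\<lambda>t. - (cos t ^ Suc n) / Suc n) b - (\<lambda>t. - (cos t ^ Suc n) / Suc n) a"
    unfolding set_lebesgue_integral_def
    by (rule integral_FTC_Icc[OF assms])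
       (auto intro!: derivative_eq_intros continuous_intros simp: has_real_derivative_iff_has_vector_derivative[symmetric] simp del: power_Suc of_nat_Suc)
  also have "\<dots> = (cos a ^ Suc n - cos b ^ Suc n) / Suc n"
    by (simp only: diff_divide_distrib minus_divide_left)
  finally show ?thesis .
qed

text \<open>
  In the variable \<open>z = cos t\<close> the hypothesis is \<open>(n + 2) m\<^bsub>n+1\<^esub> = (n + 4) m\<^bsub>n+3\<^esub>\<close> for the moments \<open>m\<^sub>k\<close> of \<open>f\<close> on
  \<open>[-1, 1]\<close>. It determines all moments of positive order from \<open>m\<^sub>1\<close> and \<open>m\<^sub>2\<close>, and the step function with
  values \<open>a\<close> and \<open>b\<close> below has the same ones. The moment of order zero is not controlled, so the comparison is
  made after multiplication by \<open>cos t\<close>, which vanishes only at the equator.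
\<close>

lemma moment_recurrence_imp_step:
  fixes f :: "real \<Rightarrow> real"
  assumes f: "f \<in> borel_measurable borel" "\<And>t. \<bar>f t\<bar> \<le> C"
    and rec: "\<And>n::nat. (real n + 2) * (LINT t:{0..pi}|lborel. f t * (cos t ^ (n + 1) * sin t))
       = (real n + 4) * (LINT t:{0..pi}|lborel. f t * (cos t ^ (n + 3) * sin t))"
  obtains a b where "AE t in lborel. t \<in> {0..pi} \<longrightarrow> f t = (if t \<le> pi / 2 then a else b)"
proof -
  define m where "m n = (LINT t:{0..pi}|lborel. f t * (cos t ^ n * sin t))" for n
  have rec: "(real n + 2) * m (n + 1) = (real n + 4) * m (n + 3)" for n
    using rec[of n] by (simp add: m_def)
  have odd: "(real (2*j) + 2) * m (2*j + 1) = 2 * m 1" for j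
  proof (induction j)
    case (Suc j)
    then show ?case using rec[of "2*j"] by (simp add: eval_nat_numeral algebra_simps)
  qed simp
  have even: "(real (2*j) + 3) * m (2*j + 2) = 3 * m 2" for j
  proof (induction j)
    case (Suc j)
    then show ?case using rec[of "2*j+1"] by (simp add: eval_nat_numeral algebra_simps)
  qed (simp add: numeral_2_eq_2)
  define a where "a = (2 * m 1 + 3 * m 2) / 2"
  define b where "b = (3 * m 2 - 2 * m 1) / 2"
  define g where "g t = (if t < pi / 2 then a else b)" for t :: real
  have mg: "m (Suc n) = (a + (-1) ^ Suc n * b) / (real n + 2)" for n
  proof (cases "even n")
    case True
    then obtain j where j: "n = 2 * j" by (auto elim: evenE)
    show ?thesis using odd[of j] unfolding j a_def b_def by (simp add: field_simps)
  next
    case False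
    then obtain j where j: "n = 2 * j + 1" by (auto elim: oddE)
    show ?thesis using even[of j] unfolding j a_def b_def by (simp add: field_simps)
  qed
  have [measurable]: "g \<in> borel_measurable borel" "f \<in> borel_measurable borel"
    using f unfolding g_def by measurable
  define C' where "C' = \<bar>a\<bar> + \<bar>b\<bar> + C"
  have C': "\<bar>g t\<bar> \<le> C'" "\<bar>f t\<bar> \<le> C'" "0 \<le> C'" for t
    using f(2)[of t] unfolding C'_def g_def by (auto split: if_splits)
  have int: "set_integrable lborel {c..d} (\<lambda>t. h t * (cos t ^ n * sin t))" 
    if [measurable]: "h \<in> borel_measurable borel" and h: "\<And>t. \<bar>h t\<bar> \<le> C'" for h n c d
  proof (rule set_integrable_bounded_Icc[where C=C'])
    fix t
    have "\<bar>h t\<bar> * \<bar>cos t ^ n * sin t\<bar> \<le> C' * 1"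
      using h C'(3) by (intro mult_mono) (auto simp: abs_mult power_abs power_le_one intro!: mult_le_one)
    then show "\<bar>h t * (cos t ^ n * sin t)\<bar> \<le> C'" by (simp add: abs_mult)
  qed measurable
  have gm: "(LINT t:{0..pi}|lborel. g t * (cos t ^ Suc n * sin t)) = (a + (-1) ^ Suc n * b) / (real n + 2)" for n
  proof -
    have i: "set_integrable lborel {c..d} (\<lambda>t. g t * (cos t ^ Suc n * sin t))" for c d
      by (intro int C') measurable
    have "(LINT t:{0..pi}|lborel. g t * (cos t ^ Suc n * sin t))
       = (LINT t:{0..<pi/2} \<union> {pi/2..pi}|lborel. g t * (cos t ^ Suc n * sin t))"
      using pi_ge_zero by (intro arg_cong2[where f="set_lebesgue_integral lborel"] refl) auto
    also have "\<dots> = (LINT t:{0..<pi/2}|lborel. g t * (cos t ^ Suc n * sin t))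
       + (LINT t:{pi/2..pi}|lborel. g t * (cos t ^ Suc n * sin t))"
      by (intro set_integral_Un set_integrable_subset[OF i[of 0 pi]]) auto
    also have "(LINT t:{0..<pi/2}|lborel. g t * (cos t ^ Suc n * sin t)) = 
        (LINT t:{0..<pi/2}|lborel. a * (cos t ^ Suc n * sin t))"
      by (intro set_lebesgue_integral_cong) (auto simp: g_def)
    also have "\<dots> = (LINT t:{0..pi/2}|lborel. a * (cos t ^ Suc n * sin t))"
      unfolding set_lebesgue_integral_def
    proof (rule integral_cong_AE)
      show "AE t in lborel. indicat_real {0..<pi/2} t *\<^sub>R (a * (cos t ^ Suc n * sin t)) =
         indicat_real {0..pi/2} t *\<^sub>R (a * (cos t ^ Suc n * sin t))"
        using AE_lborel_singleton[of "pi/2"] by eventually_elim (auto simp: indicator_def)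
    qed measurable
    also have "(LINT t:{pi/2..pi}|lborel. g t * (cos t ^ Suc n * sin t)) = 
        (LINT t:{pi/2..pi}|lborel. b * (cos t ^ Suc n * sin t))"
      by (intro set_lebesgue_integral_cong) (auto simp: g_def)
    finally show ?thesis
      by (simp del: power_Suc add: integral_cos_power_sin)
         (simp add: divide_simps, simp add: algebra_simps)
  qed
  have "AE t in lborel. t \<in> {0..pi} \<longrightarrow> (f t - g t) * (cos t * sin t) = 0"
  proof (rule orthogonal_to_cos_powers_imp_zero[where C="2 * C'"])
    show "\<bar>(f t - g t) * (cos t * sin t)\<bar> \<le> 2 * C'" for t
    proof -
      have "\<bar>f t - g t\<bar> \<le> 2 * C'" using C'(1,2)[of t] by linarith
      then have "\<bar>f t - g t\<bar> * \<bar>cos t * sin t\<bar> \<le> (2 * C') * 1"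
        by (intro mult_mono) (auto simp: abs_mult C' intro!: mult_le_one)
      then show ?thesis by (simp add: abs_mult)
    qed
    show "(LINT t:{0..pi}|lborel. (f t - g t) * (cos t * sin t) * cos t ^ n) = 0" for n
    proof -
      have "(LINT t:{0..pi}|lborel. (f t - g t) * (cos t * sin t) * cos t ^ n) =
         (LINT t:{0..pi}|lborel. f t * (cos t ^ Suc n * sin t) - g t * (cos t ^ Suc n * sin t))"
        by (simp add: algebra_simps)
      also have "\<dots> = m (Suc n) - (LINT t:{0..pi}|lborel. g t * (cos t ^ Suc n * sin t))"
        unfolding m_def by (intro set_integral_diff int C') measurable
      finally show ?thesis unfolding gm mg by simp
    qed
  qed measurable
  then have "AE t in lborel. t \<in> {0..pi} \<longrightarrow> f t = (if t \<le> pi / 2 then a else b)"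
    using AE_lborel_singleton[of "pi/2"] AE_lborel_singleton[of 0] AE_lborel_singleton[of pi]
  proof eventually_elim
    case (elim t)
    have "sin t > 0" if "t \<in> {0..pi}"
      using elim(2-) that by (intro sin_gt_zero) auto
    moreover have "cos t \<noteq> 0" if "t \<in> {0..pi}"
    proof
      assume "cos t = 0"
      then have "t = pi / 2" using that arccos_cos[of t] by simp
      then show False using elim by simp
    qed
    ultimately show ?case using elim(1,2) by (force simp: g_def)
  qed
  then show ?thesis by (rule that)
qed

section \<open>The calibration inequality and its equality case\<close>

lemma cap_height_integral:
  assumes t: "t \<in> {0..pi}"
  shows "height_integral (cap t) = pi * (sin t)\<^sup>2"
    and "(LINT x:cap t|surface_measure. 1) = 2 * pi * (1 - cos t)"
proof -
  have z: "(LINT x:cap t|surface_measure. h (x $ 3)) = 2 * pi * (H t - H 0)"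
    if h: "continuous_on UNIV h" and H: "\<And>u S. (H has_vector_derivative sin u * h (cos u)) (at u within S)" 
    for h H :: "real \<Rightarrow> real"
  proof -
    have hc: "continuous_on S (\<lambda>x. h (f x))" if "continuous_on S f" for S and f :: "'b::topological_space \<Rightarrow> real"
      using continuous_on_compose2[OF h that] by simp
    have "(LINT x:cap t|surface_measure. h (x $ 3)) = 
        integral (cbox (0, 0) (t, 2 * pi)) (\<lambda>z. sin (fst z) * h (sphere_coords z $ 3))"
      by (intro cap_integral t hc continuous_intros)
    also have "\<dots> = integral (cbox (0, 0) (t, 2 * pi)) (\<lambda>z. sin (fst z) * h (cos (fst z)))"
      by (simp add: sphere_coords_nth(3)[of "fst z" "snd z" for z, simplified])
    also have "\<dots> = integral (cbox 0 t) (\<lambda>u. integral (cbox 0 (2 * pi)) (\<lambda>p. sin (fst (u, p)) * h (cos (fst (u, p)))))"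
      by (rule integral_prod_continuous) (intro continuous_intros hc)
    also have "\<dots> = integral (cbox 0 t) (\<lambda>u. 2 * pi * (sin u * h (cos u)))"
      by (rule arg_cong[where f="integral (cbox 0 t)"]) (simp add: fun_eq_iff)
    also have "\<dots> = 2 * pi * integral (cbox 0 t) (\<lambda>u. sin u * h (cos u))"
      by (rule Henstock_Kurzweil_Integration.integral_mult_right)
    also have "integral (cbox 0 t) (\<lambda>u. sin u * h (cos u)) = H t - H 0"
      using fundamental_theorem_of_calculus[OF _ H, of 0 t] t by (intro integral_unique) auto
    finally show ?thesis .
  qed
  have "((\<lambda>u. (sin u)\<^sup>2 / 2) has_vector_derivative sin u * cos u) (at u within S)" for u :: real and S
    by (auto intro!: derivative_eq_intros simp: has_real_derivative_iff_has_vector_derivative[symmetric])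
  from z[OF continuous_on_id this] show "height_integral (cap t) = pi * (sin t)\<^sup>2"
    by simp
  have "((\<lambda>u. - cos u) has_vector_derivative sin u * 1) (at u within S)" for u :: real and S
    by (auto intro!: derivative_eq_intros simp: has_real_derivative_iff_has_vector_derivative[symmetric])
  from z[OF continuous_on_const this] show "(LINT x:cap t|surface_measure. 1) = 2 * pi * (1 - cos t)"
    by simp
qed

lemma AE_coord_iff:
  "(AE z in coord_measure. P z) \<longleftrightarrow> (AE z in lborel. z \<in> rect \<and> 0 < sin (fst z) \<longrightarrow> P z)"
proof -
  have "(\<lambda>z. ennreal (sin (fst z) * indicator rect z)) \<in> borel_measurable lborel"
    using measurable_sin_fst_rect by measurable
  from AE_density[OF this] show ?thesis
    unfolding coord_measure_rect by (auto simp: indicator_def split: if_splits intro!: AE_cong)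
qed

lemma AE_lborel_fst:
  fixes P :: "real \<Rightarrow> bool"
  assumes "AE t in lborel. P t"
  shows "AE z in (lborel :: (real \<times> real) measure). P (fst z)"
proof -
  obtain N where N: "{t. \<not> P t} \<subseteq> N" "N \<in> null_sets lborel"
    using assms unfolding eventually_ae_filter by auto
  have "N \<times> UNIV \<in> null_sets (lborel \<Otimes>\<^sub>M (lborel :: real measure))"
    using lborel.times_in_null_sets1[OF N(2), of UNIV] by simp
  then have "AE z in lborel \<Otimes>\<^sub>M (lborel :: real measure). z \<notin> N \<times> UNIV" by (rule AE_not_in)
  then show ?thesis unfolding lborel_prod by eventually_elim (use N(1) in \<open>auto simp: mem_Times_iff\<close>)
qed

lemma rot_e3_sphere_coords: "rot_e3 a (sphere_coords (t, p)) = sphere_coords (t, p + a)"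
  by (simp add: vec_eq_iff forall_3 rot_e3_def cos_add sin_add algebra_simps)

lemma axisymmetric_sphere_coords:
  assumes "axisymmetric F"
  shows "sphere_coords (t, p) \<in> F \<longleftrightarrow> sphere_coords (t, q) \<in> F"
proof -
  have "sphere_coords (t, r + a) \<in> F" if "sphere_coords (t, r) \<in> F" for r a
  proof -
    have "rot_e3 a (sphere_coords (t, r)) \<in> rot_e3 a ` F" using that by (rule imageI)
    then show ?thesis using assms unfolding axisymmetric_def rot_e3_sphere_coords by simp
  qed
  from this[of p "q - p"] this[of q "p - q"] show ?thesis by auto
qed

text \<open>
  An axisymmetric set is given by a set of polar angles, which need not be Borel. Averaging a Borel
  representative over the longitude yields a Borel profile \<open>f\<close>, which by Fubini agrees with the
  indicator almost everywhere.
\<close>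

lemma axisymmetric_profile:
  assumes F: "F \<in> sets surface_measure" and ax: "axisymmetric F"
  shows "\<exists>f :: real \<Rightarrow> real. f \<in> borel_measurable borel \<and> (\<forall>t. \<bar>f t\<bar> \<le> 1) \<and>
    (AE z in coord_measure. indicator F (sphere_coords z) = f (fst z)) \<and>
    (\<forall>h. continuous_on UNIV h \<longrightarrow>
       (LINT x:F|surface_measure. h (x $ 3)) = 2 * pi * (LINT t:{0..pi}|lborel. f t * (h (cos t) * sin t)))"
proof -
  obtain G where G: "G \<in> sets borel_surface_measure" "AE x in borel_surface_measure. x \<in> G \<longleftrightarrow> x \<in> F"
    using obtain_borel_rep[OF F] .
  define ind where "ind z = indicat_real G (sphere_coords z)" for z
  have "indicat_real G \<in> borel_measurable (restrict_space borel S2)"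
    using G(1) unfolding sets_borel_surface by (rule borel_measurable_indicator)
  from measurable_compose[OF sphere_coords_measurable this] 
  have ind[measurable]: "ind \<in> borel_measurable borel" unfolding ind_def .
  define f where "f t = (LINT p|lborel. indicator {0..2 * pi} p * ind (t, p)) / (2 * pi)" for t
  have "(\<lambda>(t, p). indicator {0..2 * pi} p * ind (t, p)) \<in> borel_measurable (borel \<Otimes>\<^sub>M lborel)"
    unfolding case_prod_unfold prod.collapse
  proof -
    have "ind \<in> borel_measurable (borel \<Otimes>\<^sub>M lborel)"
      using ind by (simp cong: measurable_cong_sets add: borel_prod[symmetric])
    then show "(\<lambda>z. indicator {0..2 * pi} (snd z) * ind z) \<in> borel_measurable (borel \<Otimes>\<^sub>M lborel)" by measurable
  qed
  then have f[measurable]: "f \<in> borel_measurable borel"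
    unfolding f_def by (intro borel_measurable_divide borel_measurable_const lborel.borel_measurable_lebesgue_integral)
  have i01: "integrable lborel (\<lambda>p. indicator {0..2 * pi} p * ind (t, p))" for t
  proof (rule Bochner_Integration.integrable_bound)
    show "integrable lborel (indicat_real {0..2 * pi})" by simp
    have "(\<lambda>p. ind (t, p)) \<in> borel_measurable borel"
      by (rule measurable_compose[OF _ ind]) simp
    then show "(\<lambda>p. indicator {0..2 * pi} p * ind (t, p)) \<in> borel_measurable lborel" by measurable
  qed (auto simp: ind_def indicator_def)
  have f1: "\<bar>f t\<bar> \<le> 1" for t
  proof -
    have "(LINT p|lborel. indicator {0..2 * pi} p * ind (t, p)) \<le> (LINT p|lborel. indicator {0..2 * pi} p)"
    proof (rule integral_mono[OF i01])
      show "integrable lborel (indicat_real {0..2 * pi})" by simp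
    qed (auto simp: ind_def indicator_def)
    moreover have "0 \<le> (LINT p|lborel. indicator {0..2 * pi} p * ind (t, p))"
      by (intro integral_nonneg_AE AE_I2) (auto simp: ind_def)
    ultimately show ?thesis unfolding f_def by (simp add: divide_simps)
  qed
  have "AE z in coord_measure. ind z = indicator F (sphere_coords z)"
    using AE_sphere_coords[OF G(2)] by eventually_elim (auto simp: ind_def indicator_def)
  then have "AE z in lborel \<Otimes>\<^sub>M lborel. z \<in> rect \<and> 0 < sin (fst z) \<longrightarrow> ind z = indicator F (sphere_coords z)"
    unfolding AE_coord_iff lborel_prod .
  from lborel_pair.AE_pair[OF this]
  have profile: "AE t in lborel. t \<in> {0..pi} \<and> 0 < sin t \<longrightarrow> f t = indicator F (sphere_coords (t, 0))"
  proof eventually_elim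
    case (elim t)
    show ?case
    proof
      assume t: "t \<in> {0..pi} \<and> 0 < sin t"
      have "(LINT p|lborel. indicator {0..2 * pi} p * ind (t, p)) =
         (LINT p|lborel. indicator {0..2 * pi} p * indicator F (sphere_coords (t, 0)))"
      proof (rule integral_cong_AE)
        show "AE p in lborel. indicator {0..2 * pi} p * ind (t, p) = 
           indicator {0..2 * pi} p * indicator F (sphere_coords (t, 0))"
          using elim 
        proof eventually_elim
          case (elim p)
          show ?case
            using elim t axisymmetric_sphere_coords[OF ax, of t p 0] by (auto simp: indicator_def rect_def)
        qed
      qed (use i01 in auto)
      then show "f t = indicator F (sphere_coords (t, 0))" by (simp add: f_def)
    qed
  qed
  have ae: "AE z in coord_measure. indicator F (sphere_coords z) = f (fst z)"
    unfolding AE_coord_iff using AE_lborel_fst[OF profile]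
  proof eventually_elim
    case (elim z)
    obtain t p where z: "z = (t, p)" by (cases z)
    show ?case using elim axisymmetric_sphere_coords[OF ax, of t p 0]
      by (auto simp: z rect_def indicator_def)
  qed
  have "(LINT x:F|surface_measure. h (x $ 3)) = 2 * pi * (LINT t:{0..pi}|lborel. f t * (h (cos t) * sin t))"
    if h: "continuous_on UNIV h" for h :: "real \<Rightarrow> real"
  proof -
    have hc: "continuous_on S (\<lambda>x. h (g x))" if "continuous_on S g" for S and g :: "'b::topological_space \<Rightarrow> real"
      using continuous_on_compose2[OF h that] by simp
    define k where "k z = sin (fst z) * h (cos (fst z))" for z :: "real \<times> real"
    have kc: "continuous_on S k" for S unfolding k_def by (intro continuous_intros hc)
    have [measurable]: "k \<in> borel_measurable borel" by (rule borel_measurable_continuous_onI[OF kc])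
    have kint: "integrable (lborel \<Otimes>\<^sub>M lborel) (\<lambda>z. indicat_real rect z * (ind z * k z))"
      unfolding lborel_prod
    proof (rule Bochner_Integration.integrable_bound)
      have "compact rect" unfolding rect_def by (intro compact_Times) auto
      then show "integrable lborel (\<lambda>z. indicat_real rect z *\<^sub>R k z)"
        by (intro borel_integrable_compact kc)
      show "(\<lambda>z. indicat_real rect z * (ind z * k z)) \<in> borel_measurable lborel" by measurable
    qed (auto simp: ind_def indicator_def)
    have "(LINT x:F|surface_measure. h (x $ 3)) =
      (LINT z:rect|lborel. sin (fst z) * (indicator G (sphere_coords z) * h (sphere_coords z $ 3)))"
      by (intro set_integral_sphere_coords G F borel_measurable_continuous_onI hc continuous_intros)
    also have "\<dots> = (LINT z|(lborel \<Otimes>\<^sub>M lborel). indicat_real rect z * (ind z * k z))"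
      unfolding lborel_prod set_lebesgue_integral_def
      by (intro Bochner_Integration.integral_cong refl) 
         (auto simp: ind_def k_def sphere_coords_nth(3)[of "fst z" "snd z" for z, simplified])
    also have "\<dots> = (LINT t|lborel. LINT p|lborel. indicat_real rect (t, p) * (ind (t, p) * k (t, p)))"
      by (rule lborel_pair.integral_fst'[OF kint, symmetric])
    also have "\<dots> = (LINT t|lborel. indicat_real {0..pi} t * (sin t * h (cos t)) * (LINT p|lborel. indicator {0..2 * pi} p * ind (t, p)))"
      by (subst integral_mult_right_zero[symmetric])
         (intro Bochner_Integration.integral_cong refl, auto simp: rect_def k_def indicator_def)
    also have "\<dots> = 2 * pi * (LINT t:{0..pi}|lborel. f t * (h (cos t) * sin t))"
      unfolding set_lebesgue_integral_def
      by (subst integral_mult_right_zero[symmetric])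
         (intro Bochner_Integration.integral_cong refl, simp add: f_def)
    finally show ?thesis .
  qed
  then show ?thesis using f f1 ae by (intro exI[of _ f]) simp
qed

text \<open>
  If the calibration is sharp for \<open>F\<close>, then \<open>F\<close> maximizes the flux of \<open>X\<^sub>0\<close> among nearby fields, and the
  perturbations by \<open>power_field\<close> with both signs of \<open>e\<close> give a vanishing first variation. The resulting
  identity is the moment recurrence for the profile of \<open>F\<close>.
\<close>

lemma axisymmetric_calibration_equality:
  assumes F: "finite_perimeter F" and ax: "axisymmetric F"
    and eq: "real_perimeter F = 2 * height_integral F"
  shows "eq_ae F {} \<or> eq_ae F S2 \<or> eq_ae F (cap (pi / 2)) \<or> eq_ae F (S2 - cap (pi / 2))"
proof -
  have Fs: "F \<in> sets surface_measure" using F by (simp add: finite_perimeter_def)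
  define w where "w n z = (real n + 4) * z ^ (n + 3) - (real n + 2) * z ^ (n + 1)" for n and z :: real
  have wc: "continuous_on S (\<lambda>x. w n (g x))" if "continuous_on S g" for S n and g :: "'b::topological_space \<Rightarrow> real"
    unfolding w_def by (intro continuous_intros that)
  have w0: "(LINT x:F|surface_measure. w n (x $ 3)) = 0" for n
  proof -
    have le: "e * (LINT x:F|surface_measure. w n (x $ 3)) \<le> 0" if e: "\<bar>e\<bar> \<le> 1 / 4" for e
    proof -
      have "(LINT x:F|surface_measure. tangential_div (meridional_field (\<lambda>x. 1 + e * (x $ 3) ^ (n + 2))) x)
         = (LINT x:F|surface_measure. 2 * x $ 3 + e * w n (x $ 3))"
        unfolding w_def by (rule surface_set_integral_cong[OF Fs power_field(2)[OF e]])
      also have "\<dots> = 2 * height_integral F + e * (LINT x:F|surface_measure. w n (x $ 3))"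
        by (subst set_integral_add) (auto intro!: set_integrable_surface Fs continuous_intros wc)
      finally show ?thesis
        using real_perimeter_upper[OF F power_field(1)[OF e, of n]] eq by simp
    qed
    from le[of "1 / 4"] le[of "- 1 / 4"] show ?thesis by simp
  qed
  from axisymmetric_profile[OF Fs ax] obtain f :: "real \<Rightarrow> real" where
    P: "f \<in> borel_measurable borel \<and> (\<forall>t. \<bar>f t\<bar> \<le> 1) \<and>
    (AE z in coord_measure. indicator F (sphere_coords z) = f (fst z)) \<and>
    (\<forall>h. continuous_on UNIV h \<longrightarrow>
       (LINT x:F|surface_measure. h (x $ 3)) = 2 * pi * (LINT t:{0..pi}|lborel. f t * (h (cos t) * sin t)))" ..
  then have f: "f \<in> borel_measurable borel" "\<And>t. \<bar>f t\<bar> \<le> 1"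
    and fae: "AE z in coord_measure. indicator F (sphere_coords z) = f (fst z)" by simp_all
  have fint: "(LINT x:F|surface_measure. h (x $ 3)) = 2 * pi * (LINT t:{0..pi}|lborel. f t * (h (cos t) * sin t))"
    if "continuous_on UNIV h" for h using P that by simp
  have int: "set_integrable lborel {0..pi} (\<lambda>t. f t * (cos t ^ n * sin t))" for n
  proof (rule set_integrable_bounded_Icc[where C=1])
    show "(\<lambda>t. f t * (cos t ^ n * sin t)) \<in> borel_measurable borel" using f(1) by measurable
    show "\<bar>f t * (cos t ^ n * sin t)\<bar> \<le> 1" for t
      unfolding abs_mult power_abs using f(2)[of t] by (intro mult_le_one power_le_one) auto
  qed
  have "(real n + 2) * (LINT t:{0..pi}|lborel. f t * (cos t ^ (n + 1) * sin t))
       = (real n + 4) * (LINT t:{0..pi}|lborel. f t * (cos t ^ (n + 3) * sin t))" for n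
  proof -
    have "0 = (LINT t:{0..pi}|lborel. f t * (w n (cos t) * sin t))"
      using fint[OF wc[OF continuous_on_id], of n] w0[of n] by simp
    also have "\<dots> = (LINT t:{0..pi}|lborel. (real n + 4) * (f t * (cos t ^ (n + 3) * sin t)) - (real n + 2) * (f t * (cos t ^ (n + 1) * sin t)))"
      by (simp add: w_def algebra_simps)
    also have "\<dots> = (LINT t:{0..pi}|lborel. (real n + 4) * (f t * (cos t ^ (n + 3) * sin t))) - (LINT t:{0..pi}|lborel. (real n + 2) * (f t * (cos t ^ (n + 1) * sin t)))"
      by (intro set_integral_diff set_integrable_mult_right int)
    finally show ?thesis by simp
  qed
  from moment_recurrence_imp_step[OF f this] obtain a b
    where ab: "AE t in lborel. t \<in> {0..pi} \<longrightarrow> f t = (if t \<le> pi / 2 then a else b)" .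
  \<comment> \<open>The profile agrees with an indicator, so the constants matter only through being equal to 1.\<close>
  define K where "K = {x \<in> S2. if polar_angle x \<le> pi / 2 then a = 1 else b = 1}"
  have "K \<in> {{}, S2, cap (pi / 2), S2 - cap (pi / 2)}"
    using polar_angle_bounds(1) unfolding K_def cap_def by auto
  moreover have "eq_ae F K"
  proof -
    have half: "pi / 2 \<in> {0..pi}" by simp
    have K: "K \<in> sets surface_measure"
      using \<open>K \<in> _\<close> sets_cap[OF half] sets.top[of surface_measure] by auto
    have "AE z in coord_measure. fst z \<in> {0..pi} \<longrightarrow> f (fst z) = (if fst z \<le> pi / 2 then a else b)"
      unfolding AE_coord_iff using AE_lborel_fst[OF ab] by eventually_elim simp
    moreover have "AE z in coord_measure. z \<in> rect"
      unfolding AE_coord_iff by simp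
    ultimately show ?thesis
      unfolding eq_ae_iff_coord[OF Fs K] using fae
    proof eventually_elim
      case (elim z)
      obtain t p where z: "z = (t, p)" by (cases z)
      have t: "t \<in> {0..pi}" using elim by (simp add: z rect_def)
      show ?case using elim t sphere_coords_in_S2[of z] polar_angle_sphere_coords[OF t, of p]
        by (auto simp: z K_def indicator_def split: if_splits)
    qed
  qed
  ultimately show ?thesis by auto
qed

text \<open>The bathtub principle: the upper hemisphere collects all points of positive height, and any other set
  that is not almost equal to it loses a positive amount.\<close>

lemma height_integral_le_pi:
  assumes F: "F \<in> sets surface_measure"
  shows "height_integral F \<le> pi"
    and "height_integral F = pi \<Longrightarrow> eq_ae F (cap (pi / 2))"
proof -
  let ?H = "cap (pi / 2)"
  have half: "pi / 2 \<in> {0..pi}" by simp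
  note H = sets_cap[OF half]
  define d where "d x = (indicat_real ?H x - indicat_real F x) * x $ 3" for x :: R3
  have int: "set_integrable surface_measure A (\<lambda>x. x $ 3)" if "A \<in> sets surface_measure" for A
    using that by (intro set_integrable_surface continuous_intros)
  have "integrable surface_measure d"
    using Bochner_Integration.integrable_diff[OF int[OF H, unfolded set_integrable_def] int[OF F, unfolded set_integrable_def]]
    by (simp add: d_def[abs_def] left_diff_distrib)
  moreover have d0: "AE x in surface_measure. 0 \<le> d x"
  proof (rule AE_I2)
    fix x assume "x \<in> space surface_measure"
    then have "x \<in> S2" by simp
    then have "x \<in> ?H \<longleftrightarrow> 0 \<le> x $ 3" unfolding cap_eq[OF half] by simp
    then show "0 \<le> d x" by (auto simp: d_def indicator_def)
  qed
  moreover have eq: "integral\<^sup>L surface_measure d = pi - height_integral F"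
    using Bochner_Integration.integral_diff[OF int[OF H, unfolded set_integrable_def] int[OF F, unfolded set_integrable_def]]
      cap_height_integral(1)[OF half]
    by (simp add: d_def[abs_def] left_diff_distrib set_lebesgue_integral_def)
  ultimately show "height_integral F \<le> pi"
    using integral_nonneg_AE[OF d0] by simp
  assume "height_integral F = pi"
  then have "AE x in surface_measure. d x = 0"
    using integral_nonneg_eq_0_iff_AE[OF \<open>integrable surface_measure d\<close> d0] eq by simp
  then have "AE x in completion borel_surface_measure. d x = 0" unfolding surface_measure_eq .
  then have "AE z in coord_measure. d (sphere_coords z) = 0"
    unfolding AE_completion_iff by (rule AE_sphere_coords)
  moreover have "AE z in coord_measure. z \<in> rect \<and> fst z \<noteq> pi / 2"
    unfolding AE_coord_iff using AE_lborel_fst[OF AE_lborel_singleton[of "pi / 2"]] by eventually_elim simp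
  ultimately show "eq_ae F ?H"
    unfolding eq_ae_iff_coord[OF F H]
  proof eventually_elim
    case (elim z)
    obtain t p where z: "z = (t, p)" by (cases z)
    have "cos t \<noteq> 0"
      using elim arccos_cos[of t] by (auto simp: z rect_def)
    then show ?case using elim by (auto simp: z d_def indicator_def split: if_splits)
  qed
qed

section \<open>The energy in terms of height integral and perimeter\<close>

lemma set_integral_eq_ae:
  fixes f :: "R3 \<Rightarrow> real"
  assumes F: "F \<in> sets surface_measure" and FK: "eq_ae F K" and f: "continuous_on UNIV f"
  shows "(LINT x:F|surface_measure. f x) = (LINT x:K|surface_measure. f x)"
proof -
  have K: "K \<in> sets surface_measure" by (rule eq_ae_sets[OF F FK])
  have "AE x in surface_measure. x \<in> F \<longleftrightarrow> x \<in> K" using FK by (simp add: eq_ae_iff[OF F K])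
  then have "AE x in surface_measure. indicat_real F x *\<^sub>R f x = indicat_real K x *\<^sub>R f x"
    by eventually_elim (auto simp: indicator_def)
  moreover have "(\<lambda>x. indicat_real A x *\<^sub>R f x) \<in> borel_measurable surface_measure" if "A \<in> sets surface_measure" for A
    using set_integrable_surface[OF f that] unfolding set_integrable_def by (rule borel_measurable_integrable)
  ultimately show ?thesis
    unfolding set_lebesgue_integral_def using F K by (intro integral_cong_AE) blast+
qed

lemma perimeter_eq_ae:
  assumes F: "F \<in> sets surface_measure" and FK: "eq_ae F K"
  shows "perimeter F = perimeter K"
  unfolding perimeter_def
  by (intro SUP_cong refl arg_cong[where f=ereal] set_integral_eq_ae[OF F FK] continuous_tangential_div)
     (simp add: test_fields_def)

text \<open>The two bulk terms add up to the area of the sphere minus twice the height integral of \<open>F\<close>, since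
  the height integral of the whole sphere vanishes.\<close>

lemma E0_eq:
  assumes F: "F \<in> sets surface_measure"
  shows "E0 s \<beta> F = root 4 24 * s * (4 * pi - 2 * height_integral F) + pi / 2 * s\<^sup>2 * \<beta> * real_perimeter F"
proof -
  have C: "S2 - F \<in> sets surface_measure" using F sets.compl_sets[of F surface_measure] by simp
  have S2: "S2 \<in> sets surface_measure" using sets.top[of surface_measure] by simp
  have int1: "set_integrable surface_measure A (\<lambda>x. 1 :: real)" 
    and int3: "set_integrable surface_measure A (\<lambda>x. x $ 3)" if "A \<in> sets surface_measure" for A
    by (intro set_integrable_surface continuous_intros that)+
  have split: "(LINT x:S2|surface_measure. f x) = (LINT x:F|surface_measure. f x) + (LINT x:S2 - F|surface_measure. f x)"
    if "continuous_on UNIV f" for f :: "R3 \<Rightarrow> real"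
  proof -
    have "S2 = F \<union> (S2 - F)" using surface_subset[OF F] by auto
    then have "(LINT x:S2|surface_measure. f x) = (LINT x:F \<union> (S2 - F)|surface_measure. f x)" by simp
    also have "\<dots> = (LINT x:F|surface_measure. f x) + (LINT x:S2 - F|surface_measure. f x)"
      by (intro set_integral_Un set_integrable_surface that F C) auto
    finally show ?thesis .
  qed
  have area: "(LINT x:S2|surface_measure. 1 :: real) = 4 * pi" and height: "height_integral S2 = 0"
    using cap_height_integral[of pi] by (simp_all add: cap_pi)
  have "(LINT x:F|surface_measure. 1 - cos (polar_angle x)) = (LINT x:F|surface_measure. 1 - x $ 3)"
    by (rule surface_set_integral_cong[OF F]) (simp add: polar_angle_bounds)
  also have "\<dots> = (LINT x:F|surface_measure. 1) - height_integral F"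
    by (intro set_integral_diff int1 int3 F)
  finally have 1: "(LINT x:F|surface_measure. 1 - cos (polar_angle x)) = (LINT x:F|surface_measure. 1) - height_integral F" .
  have "(LINT x:S2 - F|surface_measure. 1 + cos (polar_angle x)) = (LINT x:S2 - F|surface_measure. 1 + x $ 3)"
    by (rule surface_set_integral_cong[OF C]) (simp add: polar_angle_bounds)
  also have "\<dots> = (LINT x:S2 - F|surface_measure. 1) + height_integral (S2 - F)"
    by (intro set_integral_add int1 int3 C)
  finally have 2: "(LINT x:S2 - F|surface_measure. 1 + cos (polar_angle x)) = (LINT x:S2 - F|surface_measure. 1) + height_integral (S2 - F)" .
  have "(LINT x:F|surface_measure. 1 - cos (polar_angle x)) + (LINT x:S2 - F|surface_measure. 1 + cos (polar_angle x))
     = 4 * pi - 2 * height_integral F"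
    unfolding 1 2 using split[of "\<lambda>_. 1"] split[of "\<lambda>x. x $ 3"] area height
    by (simp add: continuous_nth3)
  moreover have "E0 s \<beta> F = root 4 24 * s * ((LINT x:F|surface_measure. 1 - cos (polar_angle x)) +
      (LINT x:S2 - F|surface_measure. 1 + cos (polar_angle x))) + pi / 2 * s\<^sup>2 * \<beta> * real_perimeter F"
    unfolding E0_def by (simp only: distrib_left)
  ultimately show ?thesis by (simp only:)
qed

lemma E0_eq_ae:
  assumes F: "F \<in> sets surface_measure" and FK: "eq_ae F K"
  shows "E0 s \<beta> F = E0 s \<beta> K"
  unfolding E0_eq[OF F] E0_eq[OF eq_ae_sets[OF F FK]] perimeter_eq_ae[OF F FK]
    set_integral_eq_ae[OF F FK continuous_nth3] ..

lemma E0_cap: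
  assumes t: "t \<in> {0..pi}"
  shows "E0 s \<beta> (cap t) = 4 * root 4 24 * pi * s * (1 - (sin t)\<^sup>2 / 2) + pi\<^sup>2 * \<beta> * s\<^sup>2 * sin t"
  unfolding E0_eq[OF sets_cap[OF t]] perimeter_cap[OF t] cap_height_integral(1)[OF t]
  by (simp add: field_simps power2_eq_square)

lemma half_angle_fourth_powers: "sin (t / 2) ^ 4 + cos (t / 2) ^ 4 = 1 - (sin t)\<^sup>2 / (2 :: real)"
proof -
  have "sin t = 2 * sin (t / 2) * cos (t / 2)" using sin_double[of "t / 2"] by simp
  moreover have "(sin (t / 2))\<^sup>2 = 1 - (cos (t / 2))\<^sup>2" by (simp add: sin_squared_eq)
  ultimately show ?thesis by algebra
qed

lemma perimeter_empty: "perimeter {} = 0"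
proof -
  have "test_fields \<noteq> {}" using zero_test_field by auto
  then show ?thesis by (simp add: perimeter_def zero_ereal_def set_lebesgue_integral_def)
qed

lemma E0_empty: "E0 s \<beta> {} = 4 * root 4 24 * pi * s"
  by (subst E0_eq) (auto simp: perimeter_empty set_lebesgue_integral_def)

lemma E0_S2: "E0 s \<beta> S2 = 4 * root 4 24 * pi * s"
  using E0_cap[of pi] by (simp add: cap_pi)

section \<open>Symmetry and connectedness of latitude bands\<close>

lemma axisymmetric_height_set: "axisymmetric {x \<in> S2. Q (x $ 3)}"
proof -
  have S2: "rot_e3 a x \<in> S2 \<longleftrightarrow> x \<in> S2" for a x
  proof -
    have s: "(sin a)\<^sup>2 = 1 - (cos a)\<^sup>2" by (simp add: sin_squared_eq)
    have "rot_e3 a x \<bullet> rot_e3 a x = x \<bullet> x"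
      unfolding inner_vec_def sum_3 rot_e3_def
      apply simp
      using s by algebra
    then show ?thesis by (simp add: norm_eq_sqrt_inner)
  qed
  have inv: "rot_e3 a (rot_e3 (- a) x) = x" for a x
  proof -
    have s: "(sin a)\<^sup>2 = 1 - (cos a)\<^sup>2" by (simp add: sin_squared_eq)
    show ?thesis
      unfolding vec_eq_iff forall_3 rot_e3_def
      apply simp
      using s by (intro conjI; algebra)
  qed
  have h: "rot_e3 a x $ 3 = x $ 3" for a x by (simp add: rot_e3_def)
  have "rot_e3 a ` {x \<in> S2. Q (x $ 3)} = {x \<in> S2. Q (x $ 3)}" for a
  proof (intro equalityI subsetI)
    fix x assume "x \<in> {x \<in> S2. Q (x $ 3)}"
    then have "rot_e3 (- a) x \<in> {x \<in> S2. Q (x $ 3)}" using S2[of "- a" x] h[of "- a" x] by simp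
    then have "rot_e3 a (rot_e3 (- a) x) \<in> rot_e3 a ` {x \<in> S2. Q (x $ 3)}" by (rule imageI)
    then show "x \<in> rot_e3 a ` {x \<in> S2. Q (x $ 3)}" by (simp only: inv)
  qed (use S2 h in auto)
  then show ?thesis by (simp add: axisymmetric_def)
qed

lemma axisymmetric_S2: "axisymmetric S2"
proof -
  have "{x \<in> S2. True} = S2" by blast
  then show ?thesis using axisymmetric_height_set[of "\<lambda>_. True"] by (simp only:)
qed

lemma axisymmetric_cap: 
  assumes t: "t \<in> {0..pi}"
  shows "axisymmetric (cap t)" "axisymmetric (S2 - cap t)"
proof -
  have "cap t = {x \<in> S2. cos t \<le> x $ 3}" "S2 - cap t = {x \<in> S2. \<not> cos t \<le> x $ 3}"
    unfolding cap_eq[OF t] by auto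
  then show "axisymmetric (cap t)" "axisymmetric (S2 - cap t)"
    using axisymmetric_height_set[of "\<lambda>z. cos t \<le> z"] axisymmetric_height_set[of "\<lambda>z. \<not> cos t \<le> z"] by simp_all
qed

lemma admissible_cap: "t \<in> {0..pi} \<Longrightarrow> admissible (cap t)"
  by (simp add: admissible_def finite_perimeter_cap axisymmetric_cap)

lemma sphere_coords_surj:
  assumes x: "x \<in> S2" 
  obtains p where "x = sphere_coords (polar_angle x, p)"
proof -
  define r where "r = sin (polar_angle x)"
  have "x \<bullet> x = 1" using x by (simp add: norm_eq_1)
  then have "(x $ 1)\<^sup>2 + (x $ 2)\<^sup>2 + (cos (polar_angle x))\<^sup>2 = 1"
    using polar_angle_bounds(3)[OF x] by (simp add: inner_vec_def sum_3 power2_eq_square)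
  then have r: "(x $ 1)\<^sup>2 + (x $ 2)\<^sup>2 = r\<^sup>2" unfolding r_def sin_squared_eq by linarith
  obtain p where "x $ 1 = r * cos p" "x $ 2 = r * sin p"
  proof (cases "r = 0")
    case True
    then show ?thesis using r that by (simp add: sum_power2_eq_zero_iff)
  next
    case False
    then have "(x $ 1 / r)\<^sup>2 + (x $ 2 / r)\<^sup>2 = 1"
      using r by (simp add: power_divide flip: add_divide_distrib)
    then obtain p where "x $ 1 / r = cos p" "x $ 2 / r = sin p" by (rule sincos_total_2pi)
    then show ?thesis using False by (intro that[of p]) (simp_all add: field_simps)
  qed
  then have "x = sphere_coords (polar_angle x, p)"
    using polar_angle_bounds(3)[OF x] by (simp add: vec_eq_iff forall_3 r_def)
  then show ?thesis by (rule that)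
qed

lemma connected_latitude_band:
  assumes "connected J" "J \<subseteq> {0..pi}"
  shows "connected {x \<in> S2. polar_angle x \<in> J}"
proof -
  have "{x \<in> S2. polar_angle x \<in> J} = sphere_coords ` (J \<times> UNIV)"
  proof (intro equalityI subsetI)
    fix x assume x: "x \<in> {x \<in> S2. polar_angle x \<in> J}"
    then obtain p where "x = sphere_coords (polar_angle x, p)" using sphere_coords_surj[of x] by blast
    then show "x \<in> sphere_coords ` (J \<times> UNIV)" using x by blast
  next
    fix x assume "x \<in> sphere_coords ` (J \<times> UNIV)"
    then show "x \<in> {x \<in> S2. polar_angle x \<in> J}"
      using assms(2) sphere_coords_in_S2 polar_angle_sphere_coords by (auto simp: subset_iff)
  qed
  moreover have "connected (sphere_coords ` (J \<times> UNIV))"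
    by (intro connected_continuous_image continuous_on_frame connected_Times assms(1)) simp
  ultimately show ?thesis by simp
qed

lemma connected_cap:
  assumes t: "t \<in> {0..pi}"
  shows "connected (cap t)" "connected (S2 - cap t)"
proof -
  have "cap t = {x \<in> S2. polar_angle x \<in> {0..t}}" "S2 - cap t = {x \<in> S2. polar_angle x \<in> {t<..pi}}"
    using polar_angle_bounds by (auto simp: cap_def not_le)
  moreover have "{0..t} \<subseteq> {0..pi}" "{t<..pi} \<subseteq> {0..pi}" using t by auto
  ultimately show "connected (cap t)" "connected (S2 - cap t)"
    using connected_latitude_band[of "{0..t}"] connected_latitude_band[of "{t<..pi}"] by simp_all
qed

text \<open>The representatives named in the hypothesis are themselves axisymmetric, as the notion of
  connectedness up to null sets requires.\<close>

lemma trivial_or_hemisphere_imp_connected: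
  assumes "eq_ae F {} \<or> eq_ae F S2 \<or> eq_ae F (cap (pi / 2)) \<or> eq_ae F (S2 - cap (pi / 2))"
  shows "ae_connected_with_complement F"
proof -
  have half: "pi / 2 \<in> {0..pi}" "pi \<in> {0..pi}" by simp_all
  have S2: "connected S2" using connected_cap(1)[OF half(2)] by (simp add: cap_pi)
  have empty: "axisymmetric {}" by (simp add: axisymmetric_def)
  have sub: "cap (pi / 2) \<subseteq> S2" by (auto simp: cap_def)
  then have "S2 - (S2 - cap (pi / 2)) = cap (pi / 2)" by auto
  then show ?thesis
    unfolding ae_connected_with_complement_def
    using assms S2 empty sub axisymmetric_S2 axisymmetric_cap[OF half(1)] connected_cap[OF half(1)]
    by (metis Diff_cancel Diff_empty Diff_subset connected_empty empty_subsetI subset_refl)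
qed

section \<open>Global minimizers\<close>

lemma admissibleD:
  assumes "admissible F"
  shows "F \<in> sets surface_measure" "finite_perimeter F" "axisymmetric F"
  using assms by (auto simp: admissible_def finite_perimeter_def)

text \<open>For \<open>s > 0\<close>, the excess over the dipole energy splits into a positive multiple of the deficit in the calibration
  inequality and the perimeter times a factor that has the sign of \<open>\<beta> s - 2 c / \<pi>\<close>.\<close>

lemma E0_excess:
  assumes F: "F \<in> sets surface_measure"
  shows "E0 s \<beta> F - 4 * root 4 24 * pi * s =
     root 4 24 * s * (real_perimeter F - 2 * height_integral F) + (pi / 2 * s\<^sup>2 * \<beta> - root 4 24 * s) * real_perimeter F"
  unfolding E0_eq[OF F] by (simp add: algebra_simps)

text \<open>Zero perimeter makes the calibration sharp in both directions, and the hemispheres are then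
  excluded because the upper one has positive perimeter and the lower one has height integral \<open>-\<pi>\<close>.\<close>

lemma zero_perimeter_trivial:
  assumes F: "admissible F" and P: "real_perimeter F = 0"
  shows "eq_ae F {} \<or> eq_ae F S2"
proof -
  note a = admissibleD[OF F]
  have half: "pi / 2 \<in> {0..pi}" by simp
  have I: "height_integral F = 0" using height_integral_le_half_perimeter[OF a(2)] P by simp
  have cap: "real_perimeter (cap (pi / 2)) \<noteq> 0" by (simp add: perimeter_cap)
  have "\<not> eq_ae F (cap (pi / 2))"
    using perimeter_eq_ae[OF a(1), of "cap (pi / 2)"] P cap by auto
  moreover have "\<not> eq_ae F (S2 - cap (pi / 2))"
  proof
    assume eq: "eq_ae F (S2 - cap (pi / 2))"
    have "S2 - F \<in> sets surface_measure" using a(1) sets.compl_sets[of F surface_measure] by simp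
    moreover have "sym_diff (S2 - F) (cap (pi / 2)) = sym_diff F (S2 - cap (pi / 2))"
      using surface_subset[OF a(1)] by (auto simp: cap_def)
    ultimately have "height_integral (S2 - F) = height_integral (cap (pi / 2))"
      using eq by (intro set_integral_eq_ae continuous_nth3) (simp_all add: eq_ae_def)
    also have "\<dots> = pi" by (simp add: cap_height_integral[OF half])
    finally have "height_integral (S2 - F) = pi" .
    moreover have "height_integral S2 = height_integral F + height_integral (S2 - F)"
    proof -
      have "S2 = F \<union> (S2 - F)" using surface_subset[OF a(1)] by auto
      then have "height_integral S2 = height_integral (F \<union> (S2 - F))" by simp
      also have "\<dots> = height_integral F + height_integral (S2 - F)"
        by (intro set_integral_Un set_integrable_surface continuous_nth3 a(1)) (auto simp: \<open>S2 - F \<in> _\<close>)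
      finally show ?thesis .
    qed
    moreover have "height_integral S2 = 0" using cap_height_integral(1)[of pi] by (simp add: cap_pi)
    ultimately show False using I by simp
  qed
  ultimately show ?thesis
    using axisymmetric_calibration_equality[OF a(2,3)] P I by auto
qed

lemma is_arg_min_iff: "is_arg_min f P x \<longleftrightarrow> P x \<and> (\<forall>y. P y \<longrightarrow> f x \<le> (f y :: real))"
  by (auto simp: is_arg_min_def not_less)

lemma coupling_threshold:
  assumes "0 < s"
  shows "\<beta> * s > k * root 4 24 / pi \<longleftrightarrow> pi\<^sup>2 * \<beta> * s\<^sup>2 > k * root 4 24 * pi * s"
    and "\<beta> * s \<ge> k * root 4 24 / pi \<longleftrightarrow> pi\<^sup>2 * \<beta> * s\<^sup>2 \<ge> k * root 4 24 * pi * s"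
proof -
  have eq: "pi\<^sup>2 * \<beta> * s\<^sup>2 = (\<beta> * s * pi) * (pi * s)" "k * root 4 24 * pi * s = (k * root 4 24) * (pi * s)"
    by (simp_all add: power2_eq_square)
  have ps: "pi * s > 0" using assms by simp
  show "\<beta> * s > k * root 4 24 / pi \<longleftrightarrow> pi\<^sup>2 * \<beta> * s\<^sup>2 > k * root 4 24 * pi * s"
    unfolding eq mult_less_cancel_right_pos[OF ps] by (rule pos_divide_less_eq[OF pi_gt_zero])
  show "\<beta> * s \<ge> k * root 4 24 / pi \<longleftrightarrow> pi\<^sup>2 * \<beta> * s\<^sup>2 \<ge> k * root 4 24 * pi * s"
    unfolding eq mult_le_cancel_right_pos[OF ps] by (rule pos_divide_le_eq[OF pi_gt_zero])
qed

lemma strong_coupling: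
  assumes s: "0 < s" and b: "pi\<^sup>2 * \<beta> * s\<^sup>2 \<ge> 2 * root 4 24 * pi * s"
    and F: "admissible F"
  shows "4 * root 4 24 * pi * s \<le> E0 s \<beta> F"
    and "E0 s \<beta> F \<le> 4 * root 4 24 * pi * s \<Longrightarrow> real_perimeter F = 2 * height_integral F"
    and "E0 s \<beta> F \<le> 4 * root 4 24 * pi * s \<Longrightarrow> pi\<^sup>2 * \<beta> * s\<^sup>2 > 2 * root 4 24 * pi * s \<Longrightarrow> real_perimeter F = 0"
proof -
  note a = admissibleD[OF F]
  define P where "P = real_perimeter F"
  define d where "d = pi / 2 * s\<^sup>2 * \<beta> - root 4 24 * s"
  have d2: "2 * pi * d = pi\<^sup>2 * \<beta> * s\<^sup>2 - 2 * root 4 24 * pi * s"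
    by (simp add: d_def power2_eq_square field_simps)
  have "0 \<le> 2 * pi * d" using b unfolding d2 by simp
  then have d: "0 \<le> d" by (rule mult_left_le_imp_le[of "2 * pi" 0, simplified mult_zero_right]) simp
  have cs: "0 < root 4 24 * s" using s by simp
  have P: "0 \<le> P - 2 * height_integral F" using height_integral_le_half_perimeter[OF a(2)] unfolding P_def by linarith
  have P0: "0 \<le> P" unfolding P_def by (rule real_perimeter_nonneg)
  have ex: "E0 s \<beta> F - 4 * root 4 24 * pi * s = root 4 24 * s * (P - 2 * height_integral F) + d * P"
    using E0_excess[OF a(1)] unfolding P_def d_def .
  have n1: "0 \<le> root 4 24 * s * (P - 2 * height_integral F)" by (rule mult_nonneg_nonneg[OF less_imp_le[OF cs] P])
  have n2: "0 \<le> d * P" using d P0 by simp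
  show "4 * root 4 24 * pi * s \<le> E0 s \<beta> F" using ex n1 n2 by linarith
  assume "E0 s \<beta> F \<le> 4 * root 4 24 * pi * s"
  then have z: "root 4 24 * s * (P - 2 * height_integral F) = 0" "d * P = 0" using ex n1 n2 by linarith+
  show "real_perimeter F = 2 * height_integral F" using z(1) s unfolding P_def by simp
  assume "pi\<^sup>2 * \<beta> * s\<^sup>2 > 2 * root 4 24 * pi * s"
  then have "0 < 2 * pi * d" unfolding d2 by simp
  then show "real_perimeter F = 0" using z(2) unfolding P_def by auto
qed

text \<open>Replacing the perimeter by its lower bound \<open>2 I(F)\<close> leaves an energy that is strictly decreasing in
  \<open>I(F)\<close>, so that the largest value \<open>I = \<pi>\<close> is optimal.\<close>

lemma weak_coupling:
  assumes s: "0 < s" and \<beta>: "0 \<le> \<beta>" and b: "pi\<^sup>2 * \<beta> * s\<^sup>2 < 2 * root 4 24 * pi * s"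
    and F: "admissible F"
  shows "E0 s \<beta> (cap (pi / 2)) \<le> E0 s \<beta> F"
    and "E0 s \<beta> F \<le> E0 s \<beta> (cap (pi / 2)) \<Longrightarrow> eq_ae F (cap (pi / 2))"
proof -
  note a = admissibleD[OF F]
  define I where "I = height_integral F"
  define d where "d = 2 * root 4 24 * s - pi * s\<^sup>2 * \<beta>"
  have "pi * d = 2 * root 4 24 * pi * s - pi\<^sup>2 * \<beta> * s\<^sup>2"
    by (simp add: d_def power2_eq_square field_simps)
  then have "0 < pi * d" using b by simp
  then have d: "0 < d" by (simp add: zero_less_mult_iff)
  have half: "pi / 2 \<in> {0..pi}" by simp
  have "pi / 2 * s\<^sup>2 * \<beta> * (2 * I) \<le> pi / 2 * s\<^sup>2 * \<beta> * real_perimeter F"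
    using height_integral_le_half_perimeter[OF a(2)] \<beta> unfolding I_def by (intro mult_left_mono) auto
  then have low: "4 * root 4 24 * pi * s - d * I \<le> E0 s \<beta> F"
    unfolding E0_eq[OF a(1)] d_def I_def by (simp add: algebra_simps)
  have H: "E0 s \<beta> (cap (pi / 2)) = 4 * root 4 24 * pi * s - d * pi"
    by (simp add: E0_cap[OF half] d_def power2_eq_square algebra_simps)
  have I: "I \<le> pi" unfolding I_def by (rule height_integral_le_pi[OF a(1)])
  then have "d * I \<le> d * pi" using d by simp
  then show "E0 s \<beta> (cap (pi / 2)) \<le> E0 s \<beta> F" using low H by linarith
  assume "E0 s \<beta> F \<le> E0 s \<beta> (cap (pi / 2))"
  then have "d * pi \<le> d * I" using low H by linarith
  then have "I = pi" using d I by simp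
  then show "eq_ae F (cap (pi / 2))" unfolding I_def by (rule height_integral_le_pi(2)[OF a(1)])
qed

section \<open>The energy of caps as a function of the opening angle\<close>

text \<open>These witnesses refute local minimality by comparison with points on a prescribed side.\<close>

lemma eventually_at_within_IccD:
  assumes "\<forall>\<^sub>F u in at t within {a..b::real}. Q u" "t \<in> {a..b}"
  shows "l < t \<Longrightarrow> a \<le> l \<Longrightarrow> \<exists>u. l < u \<and> u < t \<and> Q u"
    and "t < r \<Longrightarrow> r \<le> b \<Longrightarrow> \<exists>u. t < u \<and> u < r \<and> Q u"
proof -
  obtain d where d: "d > 0" "\<And>u. u \<in> {a..b} \<Longrightarrow> u \<noteq> t \<Longrightarrow> dist u t < d \<Longrightarrow> Q u"
    using assms(1) unfolding eventually_at by blast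
  show "\<exists>u. l < u \<and> u < t \<and> Q u" if "l < t" "a \<le> l"
    by (rule exI[of _ "max ((l + t) / 2) (t - d / 2)"])
       (use d(1) that assms(2) in \<open>auto intro!: d(2) simp: dist_real_def max_def\<close>)
  show "\<exists>u. t < u \<and> u < r \<and> Q u" if "t < r" "r \<le> b"
    by (rule exI[of _ "min ((t + r) / 2) (t + d / 2)"])
       (use d(1) that assms(2) in \<open>auto intro!: d(2) simp: dist_real_def min_def\<close>)
qed

lemma sin_less_towards_half_pi:
  fixes u t :: real
  shows "0 \<le> u \<Longrightarrow> u < t \<Longrightarrow> t \<le> pi / 2 \<Longrightarrow> sin u < sin t"
    and "pi / 2 \<le> t \<Longrightarrow> t < u \<Longrightarrow> u \<le> pi \<Longrightarrow> sin u < sin t"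
proof -
  show *: "sin u < sin t" if "0 \<le> u" "u < t" "t \<le> pi / 2" for u t :: real
    using that by (intro sin_monotone_2pi) auto
  show "pi / 2 \<le> t \<Longrightarrow> t < u \<Longrightarrow> u \<le> pi \<Longrightarrow> sin u < sin t"
    using *[of "pi - u" "pi - t"] by simp
qed

lemma sin_on_Icc_0_pi:
  assumes "t \<in> {0..pi}"
  shows "0 \<le> sin t" "sin t \<le> 1" "sin t = 0 \<longleftrightarrow> t = 0 \<or> t = pi" "sin t = 1 \<longleftrightarrow> t = pi / 2"
proof -
  show "0 \<le> sin t" "sin t \<le> 1" using assms by (auto intro: sin_ge_zero)
  show "sin t = 0 \<longleftrightarrow> t = 0 \<or> t = pi" using sin_gt_zero[of t] assms by force
  show "sin t = 1 \<longleftrightarrow> t = pi / 2"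
  proof
    assume "sin t = 1"
    then show "t = pi / 2"
      using sin_less_towards_half_pi(1)[of t "pi / 2"] sin_less_towards_half_pi(2)[of "pi / 2" t] assms
      by (cases t "pi / 2" rule: linorder_cases) auto
  next
    assume "t = pi / 2" then show "sin t = 1" by (simp only: sin_pi_half)
  qed
qed


lemma local_minimizers_decreasing:
  fixes f :: "real \<Rightarrow> real"
  assumes dec: "\<And>u t. u \<in> {0..pi} \<Longrightarrow> t \<in> {0..pi} \<Longrightarrow> sin u < sin t \<Longrightarrow> f t < f u"
  shows "{t. local_minimizer_on f {0..pi} t} = {pi / 2}"
proof (intro equalityI subsetI)
  fix t assume "t \<in> {t. local_minimizer_on f {0..pi} t}"
  then have t: "t \<in> {0..pi}" and ev: "\<forall>\<^sub>F y in at t within {0..pi}. f t \<le> f y"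
    by (auto simp: local_minimizer_on_def)
  show "t \<in> {pi / 2}"
  proof (cases t "pi / 2" rule: linorder_cases)
    case less
    then obtain u where u: "t < u" "u < pi / 2" "f t \<le> f u"
      using eventually_at_within_IccD(2)[OF ev t, of "pi / 2"] by auto
    then show ?thesis using dec[of t u] sin_less_towards_half_pi(1)[of t u] t by auto
  next
    case greater
    then obtain u where u: "pi / 2 < u" "u < t" "f t \<le> f u"
      using eventually_at_within_IccD(1)[OF ev t, of "pi / 2"] by auto
    then show ?thesis using dec[of t u] sin_less_towards_half_pi(2)[of u t] t by auto
  qed simp
next
  fix t :: real assume "t \<in> {pi / 2}"
  then have t: "t = pi / 2" by simp
  have "f (pi / 2) \<le> f u" if "u \<in> {0..pi}" for u
  proof (cases "u = pi / 2")
    case False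
    then have "sin u \<noteq> 1" using sin_on_Icc_0_pi(4)[OF that] by blast
    then have "sin u < sin (pi / 2)" using sin_on_Icc_0_pi(2)[OF that] unfolding sin_pi_half by linarith
    then show ?thesis using dec[of u "pi / 2"] that by simp
  next
    case True
    show ?thesis unfolding True ..
  qed
  then show "t \<in> {t. local_minimizer_on f {0..pi} t}"
    by (auto simp: t local_minimizer_on_def eventually_at_filter)
qed

lemma local_minimizers_increasing:
  fixes f :: "real \<Rightarrow> real"
  assumes inc: "\<And>u t. u \<in> {0..pi} \<Longrightarrow> t \<in> {0..pi} \<Longrightarrow> sin u < sin t \<Longrightarrow> f u < f t"
    and ends: "f 0 = f pi"
  shows "{t. local_minimizer_on f {0..pi} t} = {0, pi}"
proof (intro equalityI subsetI)
  fix t assume "t \<in> {t. local_minimizer_on f {0..pi} t}"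
  then have t: "t \<in> {0..pi}" and ev: "\<forall>\<^sub>F y in at t within {0..pi}. f t \<le> f y"
    by (auto simp: local_minimizer_on_def)
  show "t \<in> {0, pi}"
  proof (rule ccontr)
    assume "t \<notin> {0, pi}"
    then have t': "0 < t" "t < pi" using t by auto
    show False
    proof (cases "t \<le> pi / 2")
      case True
      obtain u where u: "0 < u" "u < t" "f t \<le> f u"
        using eventually_at_within_IccD(1)[OF ev t, of 0] t' by auto
      then show ?thesis using inc[of u t] sin_less_towards_half_pi(1)[of u t] t True by auto
    next
      case False
      obtain u where u: "t < u" "u < pi" "f t \<le> f u"
        using eventually_at_within_IccD(2)[OF ev t, of pi] t' by auto
      then show ?thesis using inc[of u t] sin_less_towards_half_pi(2)[of t u] t False by auto
    qed
  qed
next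
  fix t :: real assume t: "t \<in> {0, pi}"
  have "f 0 \<le> f u" if u: "u \<in> {0..pi}" for u
  proof (cases "u = 0 \<or> u = pi")
    case False
    then have "sin 0 < sin u" using sin_on_Icc_0_pi(1,3)[OF u] by auto
    then show ?thesis using inc[of 0 u] u by simp
  qed (use ends in auto)
  then show "t \<in> {t. local_minimizer_on f {0..pi} t}"
    using t ends by (auto simp: local_minimizer_on_def eventually_at_filter)
qed

lemma cap_energy_critical_points:
  fixes f :: "real \<Rightarrow> real" and A B :: real
  assumes f: "\<And>t. t \<in> {0..pi} \<Longrightarrow> f t = A * (1 - (sin t)\<^sup>2 / 2) + B * sin t" and t: "t \<in> {0..pi}"
  shows "(f has_real_derivative 0) (at t within {0..pi}) \<longleftrightarrow> cos t * (B - A * sin t) = 0"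
proof -
  have "((\<lambda>t. A * (1 - (sin t)\<^sup>2 / 2) + B * sin t) has_real_derivative cos t * (B - A * sin t)) (at t within {0..pi})"
    by (auto intro!: derivative_eq_intros simp: algebra_simps power2_eq_square)
  then have d: "(f has_real_derivative cos t * (B - A * sin t)) (at t within {0..pi})"
    by (rule has_field_derivative_transform_within[where d=1]) (use f t in auto)
  show ?thesis
  proof
    assume "(f has_real_derivative 0) (at t within {0..pi})"
    then show "cos t * (B - A * sin t) = 0"
      using d t vector_derivative_unique_within_closed_interval[of 0 pi t f 0 "cos t * (B - A * sin t)"]
      unfolding has_real_derivative_iff_has_vector_derivative by simp
  next
    assume "cos t * (B - A * sin t) = 0"
    with d show "(f has_real_derivative 0) (at t within {0..pi})" by (simp only:)
  qed
qed

theorem mainTheorem2: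
  fixes s \<beta> :: real
  assumes "0 < s" and "0 \<le> \<beta>"
  shows
    "(\<forall>F. is_arg_min (E0 s \<beta>) admissible F \<longrightarrow> ae_connected_with_complement F)
   \<and> (\<forall>t\<in>{0..pi}. finite_perimeter (cap t) \<and>
        E0 s \<beta> (cap t) = 4 * root 4 24 * pi * s * (sin (t / 2) ^ 4 + cos (t / 2) ^ 4)
                        + pi\<^sup>2 * \<beta> * s\<^sup>2 * sin t)
   \<and> {t \<in> {0..pi}. ((\<lambda>u. E0 s \<beta> (cap u)) has_real_derivative 0) (at t within {0..pi})}
       = {t \<in> {0..pi}. cos t * (pi * \<beta> * s - 4 * root 4 24 * sin t) = 0}
   \<and> (\<beta> * s \<ge> 4 * root 4 24 / pi \<longrightarrow>
        {t. local_minimizer_on (\<lambda>u. E0 s \<beta> (cap u)) {0..pi} t} = {0, pi})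
   \<and> (\<beta> * s = 2 * root 4 24 / pi \<longrightarrow> E0 s \<beta> (cap (pi / 2)) = E0 s \<beta> (cap 0))
   \<and> (\<beta> * s > 2 * root 4 24 / pi \<longrightarrow>
        {t. is_arg_min (\<lambda>u. E0 s \<beta> (cap u)) (\<lambda>u. u \<in> {0..pi}) t} = {0, pi} \<and>
        {F. is_arg_min (E0 s \<beta>) admissible F}
          = {F. admissible F \<and> (eq_ae F {} \<or> eq_ae F S2)})
   \<and> (\<beta> * s < 2 * root 4 24 / pi \<longrightarrow>
        {t. is_arg_min (\<lambda>u. E0 s \<beta> (cap u)) (\<lambda>u. u \<in> {0..pi}) t} = {pi / 2} \<and>
        {F. is_arg_min (E0 s \<beta>) admissible F}
          = {F. admissible F \<and> eq_ae F (cap (pi / 2))})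
   \<and> ({t. local_minimizer_on (\<lambda>u. E0 s \<beta> (cap u)) {0..pi} t} = {pi / 2} \<longleftrightarrow> \<beta> * s = 0)"
proof -
  define A where "A = 4 * root 4 24 * pi * s"
  define B where "B = pi\<^sup>2 * \<beta> * s\<^sup>2"
  define E where "E u = E0 s \<beta> (cap u)" for u
  have A: "0 < A" using assms by (simp add: A_def)
  have B: "0 \<le> B" using assms by (simp add: B_def)
  have E: "E t = A * (1 - (sin t)\<^sup>2 / 2) + B * sin t" if "t \<in> {0..pi}" for t
    unfolding E_def A_def B_def by (rule E0_cap[OF that])
  have A2: "2 * root 4 24 * pi * s = A / 2" by (simp add: A_def)
  \<comment> \<open>The cap energy is a quadratic polynomial in the sine; its difference quotient decides every
    comparison between caps.\<close>
  have diff: "E u - E t = (sin t - sin u) * (A * (sin t + sin u) / 2 - B)" if "u \<in> {0..pi}" "t \<in> {0..pi}" for u t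
    using that by (simp add: E field_simps power2_eq_square)
  have half: "pi / 2 \<in> {0..pi}" "0 \<in> {0..pi}" "pi \<in> {0..pi}" by simp_all
  have strong: "\<beta> * s > 2 * root 4 24 / pi \<longleftrightarrow> A / 2 < B" "\<beta> * s \<ge> 2 * root 4 24 / pi \<longleftrightarrow> A / 2 \<le> B"
    using coupling_threshold[OF assms(1), of 2 \<beta>] unfolding A2 B_def[symmetric] by simp_all
  have strong4: "\<beta> * s \<ge> 4 * root 4 24 / pi \<longleftrightarrow> A \<le> B"
    using coupling_threshold[OF assms(1), of 4 \<beta>] unfolding A_def B_def by simp
  have E0A: "E0 s \<beta> {} = A" "E0 s \<beta> S2 = A" "E 0 = A" "E pi = A"
    using E[OF half(2)] E[OF half(3)] by (simp_all add: E0_empty E0_S2 A_def)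

  have i: "ae_connected_with_complement F" if "is_arg_min (E0 s \<beta>) admissible F" for F
  proof -
    have F: "admissible F" and min: "\<And>t. t \<in> {0..pi} \<Longrightarrow> E0 s \<beta> F \<le> E t"
      using that admissible_cap unfolding is_arg_min_iff E_def by auto
    show ?thesis
    proof (cases "A / 2 \<le> B")
      case True
      have "real_perimeter F = 2 * height_integral F"
        using strong_coupling(2)[OF assms(1) _ F] True min[OF half(2)] unfolding A2 B_def E0A A_def by simp
      with axisymmetric_calibration_equality[of F] F show ?thesis
        by (intro trivial_or_hemisphere_imp_connected) (simp add: admissible_def)
    next
      case False
      have "eq_ae F (cap (pi / 2))"
        using weak_coupling(2)[OF assms _ F] False min[OF half(1)] unfolding A2 B_def E_def by simp
      then show ?thesis by (intro trivial_or_hemisphere_imp_connected) simp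
    qed
  qed

  have ii: "finite_perimeter (cap t) \<and> E t = A * (sin (t / 2) ^ 4 + cos (t / 2) ^ 4) + B * sin t"
    if "t \<in> {0..pi}" for t
    using finite_perimeter_cap[OF that] E[OF that] by (simp add: half_angle_fourth_powers)

  have crit: "(E has_real_derivative 0) (at t within {0..pi}) \<longleftrightarrow> cos t * (pi * \<beta> * s - 4 * root 4 24 * sin t) = 0"
    if "t \<in> {0..pi}" for t
  proof -
    have "cos t * (B - A * sin t) = pi * s * (cos t * (pi * \<beta> * s - 4 * root 4 24 * sin t))"
      by (simp add: A_def B_def power2_eq_square algebra_simps)
    moreover have "pi * s * x = 0 \<longleftrightarrow> x = 0" for x using assms(1) by simp
    ultimately show ?thesis using cap_energy_critical_points[OF E that] by (simp only:)
  qed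

  have iii: "{t. local_minimizer_on E {0..pi} t} = {0, pi}" if "A \<le> B"
  proof (rule local_minimizers_increasing)
    fix u t :: real assume u: "u \<in> {0..pi}" and t: "t \<in> {0..pi}" and less: "sin u < sin t"
    have "sin t + sin u < 2" using less sin_on_Icc_0_pi(2)[OF t] by linarith
    then have "A * (sin t + sin u) < A * 2" using A by simp
    then have "A * (sin t + sin u) / 2 - B < 0" using that by simp
    then have "(sin t - sin u) * (A * (sin t + sin u) / 2 - B) < 0" using less by (intro mult_pos_neg) auto
    then show "E u < E t" using diff[OF u t] by simp
  qed (simp add: E0A)

  have equal: "E (pi / 2) = E 0" if "A / 2 = B"
    using that E[OF half(1)] E0A by simp

  have dipole: "A \<le> E t" "E t \<le> A \<longleftrightarrow> t = 0 \<or> t = pi" if "A / 2 < B" and t: "t \<in> {0..pi}" for t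
  proof -
    have "A * sin t \<le> A" using A sin_on_Icc_0_pi(2)[OF t] by simp
    then have pos: "B - A * sin t / 2 > 0" using that(1) by simp
    have eq: "E t - A = sin t * (B - A * sin t / 2)" using E[OF t] by (simp add: field_simps power2_eq_square)
    then show "A \<le> E t" using pos sin_on_Icc_0_pi(1)[OF t] by (smt (verit) mult_nonneg_nonneg)
    then have "E t \<le> A \<longleftrightarrow> sin t = 0" using eq pos by auto
    then show "E t \<le> A \<longleftrightarrow> t = 0 \<or> t = pi" using sin_on_Icc_0_pi(3)[OF t] by simp
  qed
  have dipole_caps: "{t. is_arg_min E (\<lambda>u. u \<in> {0..pi}) t} = {0, pi}" if "A / 2 < B"
  proof (intro set_eqI iffI)
    fix t assume "t \<in> {t. is_arg_min E (\<lambda>u. u \<in> {0..pi}) t}"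
    then have t: "t \<in> {0..pi}" and "E t \<le> E 0" using half(2) unfolding is_arg_min_iff by blast+
    then show "t \<in> {0, pi}" using dipole(2)[OF that t] E0A by simp
  next
    fix t :: real assume "t \<in> {0, pi}"
    then show "t \<in> {t. is_arg_min E (\<lambda>u. u \<in> {0..pi}) t}"
      using dipole(1)[OF that] E0A half unfolding is_arg_min_iff by auto
  qed
  have dipole_sets: "{F. is_arg_min (E0 s \<beta>) admissible F} = {F. admissible F \<and> (eq_ae F {} \<or> eq_ae F S2)}"
    if AB: "A / 2 < B"
  proof (intro set_eqI iffI)
    fix F assume "F \<in> {F. is_arg_min (E0 s \<beta>) admissible F}"
    then have F: "admissible F" and "E0 s \<beta> F \<le> A"
      using admissible_cap[OF half(2)] E0A(3) unfolding is_arg_min_iff E_def by auto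
    then have "real_perimeter F = 0"
      using strong_coupling(3)[OF assms(1) _ F] AB unfolding A2 B_def A_def by simp
    then show "F \<in> {F. admissible F \<and> (eq_ae F {} \<or> eq_ae F S2)}"
      using zero_perimeter_trivial[OF F] F by simp
  next
    fix F assume "F \<in> {F. admissible F \<and> (eq_ae F {} \<or> eq_ae F S2)}"
    then have F: "admissible F" and "eq_ae F {} \<or> eq_ae F S2" by auto
    then have "E0 s \<beta> F = A"
      using E0_eq_ae[OF admissibleD(1)[OF F]] E0A by metis
    then show "F \<in> {F. is_arg_min (E0 s \<beta>) admissible F}"
      using F strong_coupling(1)[OF assms(1)] AB unfolding is_arg_min_iff A2 B_def A_def by simp
  qed

  have ring: "E (pi / 2) \<le> E t" "E t \<le> E (pi / 2) \<longleftrightarrow> t = pi / 2" if AB: "B < A / 2" and t: "t \<in> {0..pi}" for t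
  proof -
    have "A * 1 \<le> A * (1 + sin t)" using A sin_on_Icc_0_pi(1)[OF t] by (intro mult_left_mono) auto
    then have pos: "A * (1 + sin t) / 2 - B > 0" using AB by simp
    have eq: "E t - E (pi / 2) = (1 - sin t) * (A * (1 + sin t) / 2 - B)" using diff[OF t half(1)] by simp
    then show "E (pi / 2) \<le> E t" using pos sin_on_Icc_0_pi(2)[OF t] by (smt (verit) mult_nonneg_nonneg)
    then have "E t \<le> E (pi / 2) \<longleftrightarrow> sin t = 1" using eq pos by auto
    then show "E t \<le> E (pi / 2) \<longleftrightarrow> t = pi / 2" using sin_on_Icc_0_pi(4)[OF t] by simp
  qed
  have ring_caps: "{t. is_arg_min E (\<lambda>u. u \<in> {0..pi}) t} = {pi / 2}" if "B < A / 2"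
  proof (intro set_eqI iffI)
    fix t assume "t \<in> {t. is_arg_min E (\<lambda>u. u \<in> {0..pi}) t}"
    then have t: "t \<in> {0..pi}" and "E t \<le> E (pi / 2)" using half(1) unfolding is_arg_min_iff by blast+
    then show "t \<in> {pi / 2}" using ring(2)[OF that t] by simp
  next
    fix t :: real assume "t \<in> {pi / 2}"
    then have t: "t = pi / 2" by blast
    show "t \<in> {t. is_arg_min E (\<lambda>u. u \<in> {0..pi}) t}"
      unfolding t is_arg_min_iff mem_Collect_eq using ring(1)[OF that] half(1) by blast
  qed
  have ring_sets: "{F. is_arg_min (E0 s \<beta>) admissible F} = {F. admissible F \<and> eq_ae F (cap (pi / 2))}"
    if AB: "B < A / 2"
  proof (intro set_eqI iffI)
    fix F assume "F \<in> {F. is_arg_min (E0 s \<beta>) admissible F}"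
    then have F: "admissible F" and "E0 s \<beta> F \<le> E0 s \<beta> (cap (pi / 2))"
      using admissible_cap[OF half(1)] unfolding is_arg_min_iff by auto
    then show "F \<in> {F. admissible F \<and> eq_ae F (cap (pi / 2))}"
      using weak_coupling(2)[OF assms _ F] AB unfolding A2 B_def by simp
  next
    fix F assume "F \<in> {F. admissible F \<and> eq_ae F (cap (pi / 2))}"
    then have F: "admissible F" and "eq_ae F (cap (pi / 2))" by auto
    then have "E0 s \<beta> F = E0 s \<beta> (cap (pi / 2))"
      by (intro E0_eq_ae admissibleD(1)[OF F])
    then show "F \<in> {F. is_arg_min (E0 s \<beta>) admissible F}"
      using F weak_coupling(1)[OF assms] AB unfolding is_arg_min_iff A2 B_def by simp
  qed

  have v: "{t. local_minimizer_on E {0..pi} t} = {pi / 2} \<longleftrightarrow> B = 0"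
  proof
    assume only: "{t. local_minimizer_on E {0..pi} t} = {pi / 2}"
    show "B = 0"
    proof (rule ccontr)
      assume "B \<noteq> 0"
      then have pos: "0 < 2 * B / A" using A B by simp
      \<comment> \<open>For \<open>B > 0\<close> the linear term dominates near \<open>t = 0\<close>, so that the dipole is a local minimizer.\<close>
      have "(sin \<longlongrightarrow> sin 0) (at (0::real) within {0..pi})"
        by (intro tendsto_intros)
      then have "\<forall>\<^sub>F u in at 0 within {0..pi}. sin u < 2 * B / A"
        using pos by (intro order_tendstoD(2)[where y="sin 0"]) simp_all
      moreover have "\<forall>\<^sub>F u in at 0 within {0..pi}. u \<in> {0..pi}"
        by (simp add: eventually_at_filter)
      ultimately have "\<forall>\<^sub>F u in at 0 within {0..pi}. E 0 \<le> E u"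
      proof eventually_elim
        case (elim u)
        have "A * sin u \<le> 2 * B" using elim(1) A by (simp add: field_simps)
        then have "0 \<le> sin u * (B - A * sin u / 2)" using sin_on_Icc_0_pi(1)[OF elim(2)] by simp
        then show ?case using E[OF elim(2)] E0A(3) by (simp add: field_simps power2_eq_square)
      qed
      then have "local_minimizer_on E {0..pi} 0" by (simp add: local_minimizer_on_def)
      then have "0 \<in> {pi / 2}" unfolding only[symmetric] by simp
      then show False by simp
    qed
  next
    assume B0: "B = 0"
    show "{t. local_minimizer_on E {0..pi} t} = {pi / 2}"
    proof (rule local_minimizers_decreasing)
      fix u t :: real assume u: "u \<in> {0..pi}" and t: "t \<in> {0..pi}" and less: "sin u < sin t"
      have "0 < sin t + sin u" using less sin_on_Icc_0_pi(1)[OF u] by linarith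
      then have "0 < (sin t - sin u) * (A * (sin t + sin u) / 2 - B)"
        using less A B0 by simp
      then show "E t < E u" using diff[OF u t] by simp
    qed
  qed
  have B0: "B = 0 \<longleftrightarrow> \<beta> * s = 0" using assms(1) by (simp add: B_def)

  have Eeta: "(\<lambda>u. E0 s \<beta> (cap u)) = E" by (rule ext) (simp add: E_def)
  have "{t \<in> {0..pi}. (E has_real_derivative 0) (at t within {0..pi})}
       = {t \<in> {0..pi}. cos t * (pi * \<beta> * s - 4 * root 4 24 * sin t) = 0}"
    using crit by blast
  moreover have "\<beta> * s = 2 * root 4 24 / pi \<longrightarrow> A / 2 = B" "\<beta> * s < 2 * root 4 24 / pi \<longrightarrow> B < A / 2"
    using strong by linarith+
  ultimately show ?thesis
    unfolding Eeta B0[symmetric] strong strong4 E_def[symmetric] A_def[symmetric] B_def[symmetric]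
    using i ii iii equal dipole_caps dipole_sets ring_caps ring_sets v by blast
qed

end
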